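(* Let $G$ be a factorizable graph and $X$ an odd-maximal barrier of $G$. Let $D_1,\ldots,D_k$ be the DM-components of $G_X$ (with respect to $X$), and let $\hat V_1,\ldots,\hat V_k$ be the partition of $X\cup D_X$ such that $\hat D_i:=G[\hat V_i]$ is the expansion of $D_i$ for each $i$. Then for each $i=1,\ldots,k$, the set $S_i:=X\cap\hat V_i$ coincides with a member of $\mathcal{P}_G(H_i)$ for some $H_i\in\mathcal{G}(G)$, and $\hat V_i=U^*(H_i)\setminus U(S_i)$.
   Context: All graphs are finite. A matching is a set of pairwise disjoint edges; perfect if it covers all vertices. A graph is factorizable if it has a perfect matching, factor-critical if deleting any single vertex yields the empty graph or a factorizable graph. For $X\subseteq V(G)$: $G[X]$ induced subgraph, $G-X=G[V(G)\setminus X]$, $G/X$ contraction of $X$ to one vertex (vertices/edges of $G/X$ identified with those of $G$), $\Gamma(X)$ the vertices outside $X$ adjacent to $X$, $E(G[X])$ the edges with both ends in $X$. For factorizable $G$: an edge is allowed if it lies in some perfect matching; for each connected component $C$ of the subgraph formed by allowed edges, $G[V(C)]$ is a factor-component; $\mathcal{G}(G)$ is the set of them. $X$ is separating if each $H\in\mathcal{G}(G)$ has $V(H)\subseteq X$ or $V(H)\cap X=\emptyset$. Barriers: $q_G(X)$ = number of odd components of $G-X$; $X$ is a barrier if $q_G(X)-|X|=|V(G)|-2\nu(G)$ ($\nu$ = maximum matching size). $D_X$ = vertices of odd components of $G-X$, $C_X=V(G)\setminus X\setminus D_X$. A barrier $X$ is odd-maximal if no nonempty $Y\subseteq D_X$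 makes $X\cup Y$ a barrier. Bipartite reduction: if $K_1,\ldots,K_l$ are the odd components of $G-X$, $G_X:=(G-C_X-E(G[X]))/V(K_1)/\cdots/V(K_l)$, a bipartite graph with color classes $X$ and the contracted vertices. For a bipartite factorizable graph with color classes $A,B$, its DM-components are its factor-components, and $\le_A$ (the Dulmage–Mendelsohn order) is the reflexive–transitive closure of the relation $\{(G_j,G_i): \text{some edge joins } B\cap V(G_j) \text{ and } A\cap V(G_i)\}$; this is a partial order. The DM-decomposition of $G_X$ is taken with respect to $A=X$. The expansion of a DM-component $D$ of $G_X$ is the subgraph of $G$ induced by $(V(D)\cap X)\cup\bigcup V(K_i)$, the union over the odd components $K_i$ whose contracted vertex lies in $D$. Cathedral structure: $G_1\trianglelefteq G_2$ (for $G_1,G_2\in\mathcal{G}(G)$) if there is a separating $X\supseteq V(G_1)\cup V(G_2)$ with $G[X]/V(G_1)$ factor-critical (a partial order). $u\sim_G v$ if $u,v$ are in the same factor-component and $G-u-v$ is not factorizable (an equivalence relation); $\mathcal{P}(G)$ is its set of classes and $\mathcal{P}_G(H)=\{S\in\mathcal{P}(G):S\subseteq V(H)\}$. $U^*(H)=\bigcup\{V(H'):H\trianglelefteq H'\}$, $U(H)=U^*(H)\setminus V(H)$. For $S\in\mathcal{P}_G(H)$, $U(S)$ is the union of $V(H')$ over all $H'\in\mathcal{G}(G)$ with $H\trianglelefteq H'$, $H'\ne H$, such that some connected component $K$ of $G[U(H)]$ satisfies $\Gamma(K)\cap V(H)\subseteq S$ and $V(H')\subseteq V(K)$; $U^*(S)=U(S)\cup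 S$. *)

theory Defs
  imports Main
begin

section \<open>Finite multigraphs\<close>

text \<open>
  Contraction creates parallel edges and has to keep the identity of the surviving edges, so a graph
  has a set of abstract edges, each with a two-element set of ends. Parallel edges are
  allowed, loops are not.
\<close>

record ('v, 'e) mgraph =
  verts :: "'v set"
  edges :: "'e set"
  ends :: "'e \<Rightarrow> 'v set"

definition finite_graph :: "('v, 'e) mgraph \<Rightarrow> bool" where
  "finite_graph G \<longleftrightarrow> finite (verts G) \<and> finite (edges G) \<and>
     (\<forall>e\<in>edges G. ends G e \<subseteq> verts G \<and> card (ends G e) = 2)"

definition induced :: "('v, 'e) mgraph \<Rightarrow> 'v set \<Rightarrow> ('v, 'e) mgraph" where
  "induced G X = G\<lparr>verts := verts G \<inter> X, edges := {e \<in> edges G. ends G e \<subseteq> X}\<rparr>"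

definition delete_verts :: "('v, 'e) mgraph \<Rightarrow> 'v set \<Rightarrow> ('v, 'e) mgraph" where
  "delete_verts G X = induced G (verts G - X)"

definition delete_edges :: "('v, 'e) mgraph \<Rightarrow> 'e set \<Rightarrow> ('v, 'e) mgraph" where
  "delete_edges G F = G\<lparr>edges := edges G - F\<rparr>"

definition adj :: "('v, 'e) mgraph \<Rightarrow> 'v \<Rightarrow> 'v \<Rightarrow> bool" where
  "adj G u v \<longleftrightarrow> (\<exists>e\<in>edges G. ends G e = {u, v})"

definition nbrs :: "('v, 'e) mgraph \<Rightarrow> 'v set \<Rightarrow> 'v set" where
  "nbrs G X = {v \<in> verts G - X. \<exists>u\<in>X. adj G u v}"

definition connected_rel :: "('v, 'e) mgraph \<Rightarrow> ('v \<times> 'v) set" where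
  "connected_rel G = {(u, v). u \<in> verts G \<and> v \<in> verts G \<and> (adj G)\<^sup>*\<^sup>* u v}"

definition components :: "('v, 'e) mgraph \<Rightarrow> ('v, 'e) mgraph set" where
  "components G = induced G ` (verts G // connected_rel G)"

text \<open>
  Contraction of every member of a family \<open>\<K>\<close> of pairwise disjoint vertex sets to one vertex;
  \<open>contract G {X}\<close> is \<open>G/X\<close>. The vertices of the contraction are the blocks of a partition of
  \<open>verts G\<close>: a member of \<open>\<K>\<close> is the vertex it is contracted to, and a vertex \<open>v\<close> outside all members
  is identified with \<open>{v}\<close>. Edges inside a member of \<open>\<K>\<close> disappear, all other edges are kept.
\<close>

definition block :: "'v set set \<Rightarrow> 'v \<Rightarrow> 'v set" where
  "block \<K> v = {u. u = v \<or> (\<exists>K\<in>\<K>. u \<in> K \<and> v \<in> K)}"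

definition contract :: "('v, 'e) mgraph \<Rightarrow> 'v set set \<Rightarrow> ('v set, 'e) mgraph" where
  "contract G \<K> =
     \<lparr>verts = block \<K> ` verts G,
      edges = {e \<in> edges G. \<not> (\<exists>K\<in>\<K>. ends G e \<subseteq> K)},
      ends = (\<lambda>e. block \<K> ` ends G e)\<rparr>"


section \<open>Matchings and factor-components\<close>

definition matching :: "('v, 'e) mgraph \<Rightarrow> 'e set \<Rightarrow> bool" where
  "matching G M \<longleftrightarrow> M \<subseteq> edges G \<and> (\<forall>e\<in>M. \<forall>f\<in>M. e \<noteq> f \<longrightarrow> ends G e \<inter> ends G f = {})"

definition perfect_matching :: "('v, 'e) mgraph \<Rightarrow> 'e set \<Rightarrow> bool" where
  "perfect_matching G M \<longleftrightarrow> matching G M \<and> (\<Union>e\<in>M. ends G e) = verts G"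

definition matching_number :: "('v, 'e) mgraph \<Rightarrow> nat" where
  "matching_number G = Max (card ` {M. matching G M})"

text \<open>The empty graph is factorizable, by the empty matching.\<close>

definition factorizable :: "('v, 'e) mgraph \<Rightarrow> bool" where
  "factorizable G \<longleftrightarrow> (\<exists>M. perfect_matching G M)"

definition factor_critical :: "('v, 'e) mgraph \<Rightarrow> bool" where
  "factor_critical G \<longleftrightarrow>
     (\<forall>v\<in>verts G. verts (delete_verts G {v}) = {} \<or> factorizable (delete_verts G {v}))"

definition allowed_edges :: "('v, 'e) mgraph \<Rightarrow> 'e set" where
  "allowed_edges G = {e \<in> edges G. \<exists>M. perfect_matching G M \<and> e \<in> M}"

text \<open>
  In a factorizable graph every vertex is an end of an allowed edge, so the subgraph formed by the
  allowed edges is spanning.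
\<close>

definition factor_components :: "('v, 'e) mgraph \<Rightarrow> ('v, 'e) mgraph set" where
  "factor_components G =
     {induced G (verts C) | C. C \<in> components (G\<lparr>edges := allowed_edges G\<rparr>)}"

definition separating :: "('v, 'e) mgraph \<Rightarrow> 'v set \<Rightarrow> bool" where
  "separating G X \<longleftrightarrow> X \<subseteq> verts G \<and>
     (\<forall>H\<in>factor_components G. verts H \<subseteq> X \<or> verts H \<inter> X = {})"


section \<open>Barriers\<close>

definition odd_components :: "('v, 'e) mgraph \<Rightarrow> 'v set \<Rightarrow> ('v, 'e) mgraph set" where
  "odd_components G X = {K \<in> components (delete_verts G X). odd (card (verts K))}"

definition barrier :: "('v, 'e) mgraph \<Rightarrow> 'v set \<Rightarrow> bool" where
  "barrier G X \<longleftrightarrow> X \<subseteq> verts G \<and>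
     int (card (odd_components G X)) - int (card X) =
     int (card (verts G)) - 2 * int (matching_number G)"

definition odd_part :: "('v, 'e) mgraph \<Rightarrow> 'v set \<Rightarrow> 'v set" where
  "odd_part G X = (\<Union>K\<in>odd_components G X. verts K)"

definition even_part :: "('v, 'e) mgraph \<Rightarrow> 'v set \<Rightarrow> 'v set" where
  "even_part G X = verts G - X - odd_part G X"

definition odd_maximal_barrier :: "('v, 'e) mgraph \<Rightarrow> 'v set \<Rightarrow> bool" where
  "odd_maximal_barrier G X \<longleftrightarrow> barrier G X \<and>
     \<not> (\<exists>Y. Y \<noteq> {} \<and> Y \<subseteq> odd_part G X \<and> barrier G (X \<union> Y))"

text \<open>
  The bipartite graph \<open>G\<^sub>X\<close>. Its colour classes are \<open>{{x} | x. x \<in> X}\<close>, identified with \<open>X\<close>,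
  and the contracted vertices \<open>verts K\<close> for the odd components \<open>K\<close> of \<open>G - X\<close>.
\<close>

definition bipartite_reduction :: "('v, 'e) mgraph \<Rightarrow> 'v set \<Rightarrow> ('v set, 'e) mgraph" where
  "bipartite_reduction G X =
     contract (delete_edges (delete_verts G (even_part G X)) (edges (induced G X)))
       (verts ` odd_components G X)"

text \<open>
  The members of the Dulmage-Mendelsohn decomposition of a bipartite factorizable graph; the choice
  of a colour class matters only for the order on them.
\<close>

abbreviation (input) DM_components :: "('v, 'e) mgraph \<Rightarrow> ('v, 'e) mgraph set" where
  "DM_components G \<equiv> factor_components G"

definition expansion :: "('v, 'e) mgraph \<Rightarrow> 'v set \<Rightarrow> ('v set, 'e) mgraph \<Rightarrow> ('v, 'e) mgraph" where
  "expansion G X D =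
     induced G ({x \<in> X. {x} \<in> verts D} \<union>
                \<Union>{verts K | K. K \<in> odd_components G X \<and> verts K \<in> verts D})"


section \<open>The cathedral structure\<close>

definition cathedral_le ::
  "('v, 'e) mgraph \<Rightarrow> ('v, 'e) mgraph \<Rightarrow> ('v, 'e) mgraph \<Rightarrow> bool" where
  "cathedral_le G G1 G2 \<longleftrightarrow> G1 \<in> factor_components G \<and> G2 \<in> factor_components G \<and>
     (\<exists>X. separating G X \<and> verts G1 \<union> verts G2 \<subseteq> X \<and>
          factor_critical (contract (induced G X) {verts G1}))"

definition sim :: "('v, 'e) mgraph \<Rightarrow> 'v \<Rightarrow> 'v \<Rightarrow> bool" where
  "sim G u v \<longleftrightarrow> (\<exists>H\<in>factor_components G. u \<in> verts H \<and> v \<in> verts H) \<and>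
     \<not> factorizable (delete_verts G {u, v})"

definition canonical_partition :: "('v, 'e) mgraph \<Rightarrow> 'v set set" where
  "canonical_partition G = verts G // {(u, v). sim G u v}"

definition canonical_classes :: "('v, 'e) mgraph \<Rightarrow> ('v, 'e) mgraph \<Rightarrow> 'v set set" where
  "canonical_classes G H = {S \<in> canonical_partition G. S \<subseteq> verts H}"

definition upper_closed :: "('v, 'e) mgraph \<Rightarrow> ('v, 'e) mgraph \<Rightarrow> 'v set" where
  "upper_closed G H = \<Union>{verts H' | H'. cathedral_le G H H'}"

definition upper :: "('v, 'e) mgraph \<Rightarrow> ('v, 'e) mgraph \<Rightarrow> 'v set" where
  "upper G H = upper_closed G H - verts H"

text \<open>
  The set \<open>U(S)\<close> for \<open>S \<in> canonical_classes G H\<close>; the factor-component \<open>H\<close>, which is determined by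
  \<open>S\<close>, is an explicit argument.
\<close>

definition upper_class ::
  "('v, 'e) mgraph \<Rightarrow> ('v, 'e) mgraph \<Rightarrow> 'v set \<Rightarrow> 'v set" where
  "upper_class G H S =
     \<Union>{verts H' | H'. H' \<in> factor_components G \<and> cathedral_le G H H' \<and> H' \<noteq> H \<and>
          (\<exists>K\<in>components (induced G (upper G H)).
             nbrs G (verts K) \<inter> verts H \<subseteq> S \<and> verts H' \<subseteq> verts K)}"

end

theory Submission
  imports Defs
begin

text \<open>
  By Tutte's theorem the odd components \<open>K\<close> of \<open>G - X\<close> are factor-critical, hence every matching of
  \<open>G\<^sub>X\<close> lifts to \<open>G\<close>. This makes the vertex set \<open>V\<^sub>D\<close> of the expansion of each \<open>D\<close> separating, and \<open>V\<^sub>D - s - w\<close> factorizable for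
  \<open>s \<in> S = X \<inter> V\<^sub>D\<close> and \<open>w \<in> V\<^sub>D - S\<close>. A parity argument puts \<open>S\<close> into a single factor-component \<open>H\<close>,
  which meets every odd component of \<open>D\<close>; so \<open>S\<close> is a class of \<open>\<sim>\<close>. Comparing a perfect matching
  with one of \<open>V\<^sub>D - s - w\<close> shows that \<open>V\<^sub>D\<close> witnesses \<open>H \<unlhd> H'\<close> for \<open>H' \<subseteq> V\<^sub>D\<close>, and such \<open>H'\<close> are not in
  \<open>U(S)\<close> because each odd component is connected and meets \<open>H\<close> outside \<open>S\<close>. Conversely, a vertex of
  \<open>X - S\<close> in \<open>U(H)\<close> has no edge into \<open>V\<^sub>D - S\<close>, since such an edge would be allowed; therefore
  components of \<open>G[U(H)]\<close> outside \<open>V\<^sub>D\<close> touch \<open>H\<close> only in \<open>S\<close>.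
\<close>

text \<open>Perfect matchings and the vertex sets of factor-components depend on a multigraph only
  through adjacency, so the argument is carried out for a symmetric irreflexive relation
  \<open>E\<close>. Allowed adjacency and the adjacency of \<open>G\<^sub>X\<close> are again such
  relations, so one theory of matchings and components serves \<open>G\<close>, its
  factor-components and its DM-components. The obstacle is that \<open>V\<^sub>D\<close> is
  assembled from odd components whereas \<open>H \<unlhd> H'\<close> speaks of factor-components,
  and an odd component of \<open>D\<close> may be split between \<open>H\<close> and other
  factor-components. The two levels communicate through matchings: downwards by contraction, since
  tightness of the barrier lets exactly one matching edge leave each odd component, and upwards by
  factor-criticality. In the converse inclusion the separating set behind
  \<open>H \<unlhd> H'\<close> is unknown and may run through any part of the graph. It is used only
  to obtain a matching that avoids all of \<open>H\<close> except one vertex; counting odd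
  components then locates that vertex in \<open>S\<close>.\<close>

section \<open>Perfect matchings and components of simple graphs\<close>

text \<open>
  A perfect matching of the vertex set \<open>W\<close> is an involution without fixed points that moves every
  vertex along an edge; its values outside \<open>W\<close> are irrelevant.
\<close>

definition pm :: "('a \<Rightarrow> 'a \<Rightarrow> bool) \<Rightarrow> 'a set \<Rightarrow> ('a \<Rightarrow> 'a) \<Rightarrow> bool" where
  "pm E W f \<longleftrightarrow> (\<forall>v\<in>W. f v \<in> W \<and> f (f v) = v \<and> E v (f v))"

definition matchable :: "('a \<Rightarrow> 'a \<Rightarrow> bool) \<Rightarrow> 'a set \<Rightarrow> bool" where
  "matchable E W \<longleftrightarrow> (\<exists>f. pm E W f)"

definition closed_in :: "('a \<Rightarrow> 'a \<Rightarrow> bool) \<Rightarrow> 'a set \<Rightarrow> 'a set \<Rightarrow> bool" where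
  "closed_in E W C \<longleftrightarrow> (\<forall>a\<in>C. \<forall>b\<in>W. E a b \<longrightarrow> b \<in> C)"

text \<open>Components as minimal nonempty closed sets: for a symmetric relation these are its classes.\<close>

definition comps :: "('a \<Rightarrow> 'a \<Rightarrow> bool) \<Rightarrow> 'a set \<Rightarrow> 'a set set" where
  "comps E W = {C. C \<subseteq> W \<and> C \<noteq> {} \<and> closed_in E W C \<and>
     (\<forall>Q. Q \<subseteq> C \<and> Q \<noteq> {} \<and> closed_in E W Q \<longrightarrow> Q = C)}"

definition odd_comps :: "('a \<Rightarrow> 'a \<Rightarrow> bool) \<Rightarrow> 'a set \<Rightarrow> 'a set set" where
  "odd_comps E W = {C \<in> comps E W. odd (card C)}"

definition allowed :: "('a \<Rightarrow> 'a \<Rightarrow> bool) \<Rightarrow> 'a set \<Rightarrow> 'a \<Rightarrow> 'a \<Rightarrow> bool" where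
  "allowed E V u v \<longleftrightarrow> (\<exists>f. pm E V f \<and> u \<in> V \<and> f u = v)"

lemma pmD:
  assumes "pm E W f" "v \<in> W"
  shows "f v \<in> W" "f (f v) = v" "E v (f v)"
  using assms by (auto simp: pm_def)

lemma pm_restrict:
  assumes "pm E W f" "A \<subseteq> W" "\<And>v. v \<in> A \<Longrightarrow> f v \<in> A"
  shows "pm E A f"
  using assms by (auto simp: pm_def)

lemma pm_restrict_Diff:
  assumes "pm E W f" "A \<subseteq> W" "\<And>v. v \<in> A \<Longrightarrow> f v \<in> A"
  shows "pm E (W - A) f"
proof -
  have "f v \<notin> A" if "v \<in> W - A" for v
    using that assms pmD(2)[OF assms(1), of v] by force
  thus ?thesis using assms(1) by (auto simp: pm_def)
qed

lemma pm_inj: "pm E W f \<Longrightarrow> inj_on f W"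
  by (metis inj_onI pmD(2))

lemma pm_cong:
  assumes "\<And>u v. u \<in> W \<Longrightarrow> v \<in> W \<Longrightarrow> E u v \<longleftrightarrow> E' u v"
  shows "pm E W f \<longleftrightarrow> pm E' W f"
  using assms by (auto simp: pm_def)

lemma allowed_cong:
  assumes "\<And>u v. u \<in> V \<Longrightarrow> v \<in> V \<Longrightarrow> E u v \<longleftrightarrow> E' u v"
  shows "allowed E V = allowed E' V"
  using pm_cong[of V E E', OF assms] by (auto simp: allowed_def fun_eq_iff)

lemma matchable_cong:
  assumes "\<And>u v. u \<in> W \<Longrightarrow> v \<in> W \<Longrightarrow> E u v \<longleftrightarrow> E' u v"
  shows "matchable E W \<longleftrightarrow> matchable E' W"
  using pm_cong[of W E E', OF assms] by (auto simp: matchable_def)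

lemma comps_cong:
  assumes "\<And>u v. u \<in> W \<Longrightarrow> v \<in> W \<Longrightarrow> E u v \<longleftrightarrow> E' u v"
  shows "comps E W = comps E' W"
proof -
  have "closed_in E W C \<longleftrightarrow> closed_in E' W C" if "C \<subseteq> W" for C
    using that assms unfolding closed_in_def by blast
  hence "C \<in> comps E W \<longleftrightarrow> C \<in> comps E' W" for C
    unfolding comps_def mem_Collect_eq by (meson subset_trans)
  thus ?thesis by blast
qed

lemma matchable_Union:
  assumes "\<And>P. P \<in> \<P> \<Longrightarrow> matchable E P"
    and disj: "\<And>P Q. P \<in> \<P> \<Longrightarrow> Q \<in> \<P> \<Longrightarrow> P \<noteq> Q \<Longrightarrow> P \<inter> Q = {}"
  shows "matchable E (\<Union>\<P>)"
proof -
  obtain F where F: "pm E P (F P)" if "P \<in> \<P>" for P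
    using assms(1) unfolding matchable_def by metis
  define f where "f = (\<lambda>v. F (THE P. P \<in> \<P> \<and> v \<in> P) v)"
  have eq: "f v = F P v" if "P \<in> \<P>" "v \<in> P" for v P
  proof -
    have "(THE P. P \<in> \<P> \<and> v \<in> P) = P"
      using that disj by (intro the_equality) blast+
    thus ?thesis by (simp add: f_def)
  qed
  have "pm E (\<Union>\<P>) f"
    unfolding pm_def
  proof
    fix v assume "v \<in> \<Union>\<P>"
    then obtain P where P: "P \<in> \<P>" "v \<in> P" by blast
    note D = pmD[OF F[OF P(1)] P(2)]
    show "f v \<in> \<Union>\<P> \<and> f (f v) = v \<and> E v (f v)"
      using D P eq[OF P] eq[OF P(1) D(1)] by auto
  qed
  thus ?thesis by (auto simp: matchable_def)
qed

lemma matchable_Un: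
  assumes "matchable E A" "matchable E B" "A \<inter> B = {}"
  shows "matchable E (A \<union> B)"
  using matchable_Union[of "{A, B}" E] assms by (auto simp: Int_commute)

lemma matchable_empty [simp]: "matchable E {}"
  by (simp add: matchable_def pm_def)

lemma pm_Un:
  assumes "pm E A f" "pm E B g" "A \<inter> B = {}"
  shows "pm E (A \<union> B) (\<lambda>v. if v \<in> A then f v else g v)"
  using assms by (auto simp: pm_def)

locale simple_graph =
  fixes E :: "'a \<Rightarrow> 'a \<Rightarrow> bool"
  assumes sym: "E u v \<Longrightarrow> E v u"
    and irrefl: "\<not> E v v"
begin

lemma pm_pair:
  assumes "E a b"
  shows "pm E {a, b} (\<lambda>v. if v = a then b else a)"
  using assms sym irrefl by (auto simp: pm_def)

lemma matchable_pair: "E a b \<Longrightarrow> matchable E {a, b}"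
  using pm_pair by (auto simp: matchable_def)

lemma pm_neq: "pm E W f \<Longrightarrow> v \<in> W \<Longrightarrow> f v \<noteq> v"
  using pmD(3) irrefl by metis

lemma pm_even:
  assumes "finite W" "pm E W f"
  shows "even (card W)"
  using assms
proof (induction "card W" arbitrary: W rule: less_induct)
  case less
  show ?case
  proof (cases "W = {}")
    case False
    then obtain v where v: "v \<in> W" by blast
    note D = pmD[OF less.prems(2) v] and n = pm_neq[OF less.prems(2) v]
    have p: "pm E (W - {v, f v}) f"
      using pm_restrict_Diff[OF less.prems(2), of "{v, f v}"] D v by auto
    have c: "card W = card (W - {v, f v}) + 2"
      using less.prems(1) v D(1) n card_mono[of W "{v, f v}"]
      by (simp add: card_Diff_subset numeral_2_eq_2)
    show ?thesis using less.hyps[OF _ _ p] c less.prems(1) by simp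
  qed simp
qed

text \<open>Factor-components are the components of the allowed relation, so this instance makes all
  facts on \<open>comps\<close> available for them.\<close>

lemma allowed_simple_graph: "simple_graph (allowed E V)"
proof
  fix u v assume "allowed E V u v"
  thus "allowed E V v u" unfolding allowed_def using pmD by metis
next
  fix v show "\<not> allowed E V v v" unfolding allowed_def using pm_neq by metis
qed

lemma allowed_in: "allowed E V u v \<Longrightarrow> u \<in> V \<and> v \<in> V \<and> E u v"
  unfolding allowed_def using pmD by metis

text \<open>Every pair \<open>v\<close>, \<open>f v\<close> is allowed, hence no perfect matching of
  \<open>V\<close> leaves a set closed under allowed edges.\<close>

lemma pm_closed_allowed:
  assumes "pm E V f" "closed_in (allowed E V) V Z" "Z \<subseteq> V"
  shows "pm E Z f" "pm E (V - Z) f"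
proof -
  have "f v \<in> Z" if "v \<in> Z" for v
    using assms that pmD(1)[OF assms(1), of v] unfolding closed_in_def allowed_def by blast
  thus "pm E Z f" "pm E (V - Z) f"
    using pm_restrict[OF assms(1,3)] pm_restrict_Diff[OF assms(1,3)] by auto
qed

section \<open>Components of a symmetric relation and their parity\<close>

lemma comps_disjoint:
  assumes "C \<in> comps E W" "C' \<in> comps E W" "C \<noteq> C'"
  shows "C \<inter> C' = {}"
proof (rule ccontr)
  assume "C \<inter> C' \<noteq> {}"
  moreover have "closed_in E W (C \<inter> C')"
    using assms by (auto simp: comps_def closed_in_def)
  ultimately have "C \<inter> C' = C" "C \<inter> C' = C'"
    using assms by (auto simp: comps_def)
  thus False using assms(3) by blast
qed

lemma ex_comp:
  assumes "v \<in> W"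
  obtains C where "C \<in> comps E W" "v \<in> C"
proof
  define C where "C = \<Inter>{Z. Z \<subseteq> W \<and> v \<in> Z \<and> closed_in E W Z}"
  have W: "closed_in E W W" by (auto simp: closed_in_def)
  show "v \<in> C" by (auto simp: C_def)
  have CW: "C \<subseteq> W" using W assms by (auto simp: C_def)
  have Cc: "closed_in E W C" unfolding C_def closed_in_def by blast
  have "Q = C" if Q: "Q \<subseteq> C" "Q \<noteq> {}" "closed_in E W Q" for Q
  proof (cases "v \<in> Q")
    case True
    have "C \<subseteq> Q" unfolding C_def by (rule Inter_lower) (use True Q CW in auto)
    thus ?thesis using Q(1) by blast
  next
    case False
    \<comment> \<open>By symmetry of \<open>E\<close> the rest \<open>C - Q\<close> is closed as
      well. It contains \<open>v\<close>, so the intersection \<open>C\<close> lies inside it and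
      \<open>Q\<close> would be empty.\<close>
    have "closed_in E W (C - Q)"
      unfolding closed_in_def
    proof (intro ballI impI)
      fix a b assume "a \<in> C - Q" "b \<in> W" "E a b"
      moreover have "b \<in> Q \<Longrightarrow> a \<in> Q"
        using Q(3) sym[OF \<open>E a b\<close>] \<open>a \<in> C - Q\<close> CW by (auto simp: closed_in_def)
      ultimately show "b \<in> C - Q" using Cc by (auto simp: closed_in_def)
    qed
    moreover have "C - Q \<subseteq> W" "v \<in> C - Q" using CW False \<open>v \<in> C\<close> by auto
    ultimately have "C \<subseteq> C - Q" unfolding C_def[symmetric] by (subst C_def) (rule Inter_lower, simp)
    thus ?thesis using Q by blast
  qed
  thus "C \<in> comps E W" using CW Cc \<open>v \<in> C\<close> by (auto simp: comps_def)
qed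

lemma Union_comps: "\<Union>(comps E W) = W"
proof
  show "W \<subseteq> \<Union>(comps E W)" using ex_comp by blast
qed (auto simp: comps_def)

lemma comps_closedD: "C \<in> comps E W \<Longrightarrow> a \<in> C \<Longrightarrow> b \<in> W \<Longrightarrow> E a b \<Longrightarrow> b \<in> C"
  by (auto simp: comps_def closed_in_def)

text \<open>Connectivity as an induction rule: a membership passed along the edges inside
  \<open>C\<close> spreads from one vertex to all of \<open>C\<close>, because
  \<open>C \<inter> Q\<close> is closed and \<open>C\<close> is minimal.\<close>

lemma comps_minD:
  assumes "C \<in> comps E W" "v \<in> C" "v \<in> Q"
    and "\<And>a b. a \<in> C \<Longrightarrow> a \<in> Q \<Longrightarrow> b \<in> C \<Longrightarrow> E a b \<Longrightarrow> b \<in> Q"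
  shows "C \<subseteq> Q"
proof -
  have "closed_in E W (C \<inter> Q)"
    using assms comps_closedD[OF assms(1)] by (auto simp: closed_in_def)
  hence "C \<inter> Q = C" using assms(1-3) by (auto simp: comps_def)
  thus ?thesis by blast
qed

lemma finite_comps: "finite W \<Longrightarrow> finite (comps E W)"
  by (rule finite_subset[of _ "Pow W"]) (auto simp: comps_def)

lemma finite_odd_comps: "finite W \<Longrightarrow> finite (odd_comps E W)"
  using finite_comps by (auto simp: odd_comps_def)

text \<open>Modulo 2 only the odd components contribute to the sum of all component sizes. Later
  counts miss their goal by one, and this parity closes the gap.\<close>

lemma odd_comps_parity:
  assumes "finite W"
  shows "even (card (odd_comps E W)) \<longleftrightarrow> even (card W)"
proof -
  have fin: "finite C" if "C \<in> comps E W" for C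
    using that assms finite_subset by (auto simp: comps_def)
  have "card W = card (\<Union>(comps E W))" by (simp add: Union_comps)
  also have "\<dots> = (\<Sum>C\<in>comps E W. card C)"
    using fin comps_disjoint
    by (intro card_Union_disjoint) (auto simp: pairwise_def disjnt_def)
  finally have "card W = (\<Sum>C\<in>comps E W. card C)" .
  thus ?thesis
    by (simp add: even_sum_iff[OF finite_comps[OF assms]] odd_comps_def)
qed

text \<open>No edge joins \<open>C\<close> to another component, so deleting \<open>Y\<close> leaves
  the others intact, and a component of \<open>C - Y\<close> gains no neighbours in the larger set
  \<open>W - Y\<close>.\<close>

lemma odd_comps_delete:
  assumes "finite W" "C \<in> comps E W" "Y \<subseteq> C"
  shows "(comps E W - {C}) \<union> comps E (C - Y) \<subseteq> comps E (W - Y)"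
    and "card (odd_comps E W - {C}) + card (odd_comps E (C - Y)) \<le> card (odd_comps E (W - Y))"
proof -
  show sub: "(comps E W - {C}) \<union> comps E (C - Y) \<subseteq> comps E (W - Y)"
  proof
    fix C' assume "C' \<in> (comps E W - {C}) \<union> comps E (C - Y)"
    thus "C' \<in> comps E (W - Y)"
    proof
      assume C': "C' \<in> comps E W - {C}"
      hence disj: "C' \<inter> Y = {}" using comps_disjoint[of C' W C] assms by blast
      have "Q = C'" if Q: "Q \<subseteq> C'" "Q \<noteq> {}" "closed_in E (W - Y) Q" for Q
      proof -
        have "closed_in E W Q"
          unfolding closed_in_def
        proof (intro ballI impI)
          fix a b assume ab: "a \<in> Q" "b \<in> W" "E a b"
          hence "b \<in> C'" using comps_closedD[of C' W a b] C' Q by blast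
          thus "b \<in> Q" using ab Q disj by (auto simp: closed_in_def)
        qed
        thus ?thesis using C' Q by (auto simp: comps_def)
      qed
      thus ?thesis using C' disj by (auto simp: comps_def closed_in_def)
    next
      assume C': "C' \<in> comps E (C - Y)"
      have "closed_in E (C - Y) Q" if "closed_in E (W - Y) Q" for Q
        using that assms(2) by (auto simp: closed_in_def comps_def)
      moreover have "closed_in E (W - Y) C'"
        unfolding closed_in_def
      proof (intro ballI impI)
        fix a b assume ab: "a \<in> C'" "b \<in> W - Y" "E a b"
        hence "b \<in> C" using comps_closedD[OF assms(2), of a b] C' by (auto simp: comps_def)
        thus "b \<in> C'" using ab comps_closedD[OF C', of a b] by blast
      qed
      ultimately show ?thesis using C' assms(2) by (auto simp: comps_def)
    qed
  qed
  have "(odd_comps E W - {C}) \<inter> odd_comps E (C - Y) = {}"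
  proof (rule ccontr)
    assume "(odd_comps E W - {C}) \<inter> odd_comps E (C - Y) \<noteq> {}"
    then obtain C' where "C' \<in> comps E W" "C' \<noteq> C" "C' \<in> comps E (C - Y)"
      by (auto simp: odd_comps_def)
    thus False using comps_disjoint[OF _ assms(2)] by (auto simp: comps_def)
  qed
  moreover have "finite C" using assms finite_subset by (auto simp: comps_def)
  ultimately have "card (odd_comps E W - {C}) + card (odd_comps E (C - Y))
      = card ((odd_comps E W - {C}) \<union> odd_comps E (C - Y))"
    using assms(1) by (intro card_Un_disjoint[symmetric]) (auto intro: finite_odd_comps)
  also have "\<dots> \<le> card (odd_comps E (W - Y))"
    using sub assms(1) by (intro card_mono finite_odd_comps) (auto simp: odd_comps_def)
  finally show "card (odd_comps E W - {C}) + card (odd_comps E (C - Y))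
      \<le> card (odd_comps E (W - Y))" .
qed

text \<open>A perfect matching cannot pair an odd \<open>K\<close> within itself, so some vertex of
  \<open>K\<close> is matched into \<open>T\<close>, and disjoint members use different vertices of
  \<open>T\<close>. If \<open>card T \<le> card \<K>\<close>, this injection is a bijection, which
  determines where \<open>f\<close> sends \<open>T\<close>. The family is arbitrary because the
  lemma is applied both to all odd components and to those outside one DM-component.\<close>

lemma odd_family_matched:
  assumes fin: "finite W" and f: "pm E W f" and T: "T \<subseteq> W"
    and disj: "\<And>K L. K \<in> \<K> \<Longrightarrow> L \<in> \<K> \<Longrightarrow> K \<noteq> L \<Longrightarrow> K \<inter> L = {}"
    and sub: "\<And>K. K \<in> \<K> \<Longrightarrow> K \<subseteq> W - T"
    and odd: "\<And>K. K \<in> \<K> \<Longrightarrow> odd (card K)"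
    and out: "\<And>K k u. K \<in> \<K> \<Longrightarrow> k \<in> K \<Longrightarrow> u \<in> W \<Longrightarrow> E k u \<Longrightarrow> u \<in> K \<union> T"
  shows "card \<K> \<le> card T"
    and "card T \<le> card \<K> \<Longrightarrow> t \<in> T \<Longrightarrow> \<exists>K\<in>\<K>. f t \<in> K"
    and "card T \<le> card \<K> \<Longrightarrow> K \<in> \<K> \<Longrightarrow> \<exists>!k. k \<in> K \<and> f k \<in> T"
proof -
  have "\<exists>k\<in>K. f k \<in> T" if K: "K \<in> \<K>" for K
  proof (rule ccontr)
    assume "\<not> (\<exists>k\<in>K. f k \<in> T)"
    hence "f k \<in> K" if "k \<in> K" for k
      using that out[OF K that, of "f k"] sub[OF K] pmD[OF f, of k] by auto
    hence "pm E K f" using sub[OF K] by (intro pm_restrict[OF f]) auto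
    moreover have "finite K" using sub[OF K] fin finite_subset by blast
    ultimately show False using pm_even odd[OF K] by blast
  qed
  then obtain \<kappa> where \<kappa>: "\<And>K. K \<in> \<K> \<Longrightarrow> \<kappa> K \<in> K \<and> f (\<kappa> K) \<in> T" by metis
  have inj: "inj_on (\<lambda>K. f (\<kappa> K)) \<K>"
  proof (rule inj_onI)
    fix K L assume KL: "K \<in> \<K>" "L \<in> \<K>" "f (\<kappa> K) = f (\<kappa> L)"
    hence "\<kappa> K = \<kappa> L"
      using \<kappa>[of K] \<kappa>[of L] sub[of K] sub[of L] inj_onD[OF pm_inj[OF f], of "\<kappa> K" "\<kappa> L"] by blast
    thus "K = L" using disj[OF KL(1,2)] \<kappa>[of K] \<kappa>[of L] KL by auto
  qed
  have im: "(\<lambda>K. f (\<kappa> K)) ` \<K> \<subseteq> T" using \<kappa> by auto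
  have finT: "finite T" using T fin finite_subset by blast
  show "card \<K> \<le> card T" using card_inj_on_le[OF inj im finT] .
  assume le: "card T \<le> card \<K>"
  hence eq: "(\<lambda>K. f (\<kappa> K)) ` \<K> = T"
    using card_seteq[OF finT im] card_image[OF inj] by simp
  have surj: "\<exists>K\<in>\<K>. t = f (\<kappa> K) \<and> f t = \<kappa> K" if "t \<in> T" for t
  proof -
    obtain K where K: "K \<in> \<K>" "t = f (\<kappa> K)" using \<open>t \<in> T\<close> eq by blast
    have "\<kappa> K \<in> W" using \<kappa>[OF K(1)] sub[OF K(1)] by blast
    thus ?thesis using K pmD(2)[OF f] by auto
  qed
  show "\<exists>K\<in>\<K>. f t \<in> K" if "t \<in> T" using surj[OF that] \<kappa> by metis
  show "\<exists>!k. k \<in> K \<and> f k \<in> T" if K: "K \<in> \<K>"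
  proof (rule ex1I[of _ "\<kappa> K"])
    show "\<kappa> K \<in> K \<and> f (\<kappa> K) \<in> T" using \<kappa>[OF K] .
    fix k assume k: "k \<in> K \<and> f k \<in> T"
    then obtain L where L: "L \<in> \<K>" "f (f k) = \<kappa> L" using surj by blast
    have "k = \<kappa> L" using L k sub[OF K] pmD(2)[OF f, of k] by auto
    thus "k = \<kappa> K" using \<kappa>[OF L(1)] disj[OF K L(1)] k by blast
  qed
qed

text \<open>Necessity in Tutte's theorem, from the injection in
  \<open>odd_family_matched\<close>.\<close>

lemma card_odd_comps_le:
  assumes "finite W" "matchable E W" "T \<subseteq> W"
  shows "card (odd_comps E (W - T)) \<le> card T"
proof -
  obtain f where f: "pm E W f" using assms(2) by (auto simp: matchable_def)
  show ?thesis
  proof (rule odd_family_matched(1)[OF assms(1) f assms(3)])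
    fix K assume "K \<in> odd_comps E (W - T)"
    hence K: "K \<in> comps E (W - T)" "odd (card K)" by (auto simp: odd_comps_def)
    show "K \<subseteq> W - T" "odd (card K)" using K by (auto simp: comps_def)
    show "u \<in> K \<union> T" if "k \<in> K" "u \<in> W" "E k u" for k u
      using that comps_closedD[OF K(1), of k u] by blast
    show "K \<inter> L = {}" if "L \<in> odd_comps E (W - T)" "K \<noteq> L" for L
      using comps_disjoint[OF K(1), of L] that by (auto simp: odd_comps_def)
  qed
qed

end

section \<open>Tutte's theorem\<close>

text \<open>Hall's marriage theorem, by induction on the index set. Either some proper nonempty
  \<open>J\<close> is tight, and then \<open>J\<close> and the remaining indices (with the elements
  available to \<open>J\<close> removed) are served separately; or every such \<open>J\<close> has
  an element to spare, and then one index may take an arbitrary \<open>y\<close>.\<close>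

lemma hall:
  assumes "finite I" "\<And>i. i \<in> I \<Longrightarrow> finite (A i)"
    and "\<And>J. J \<subseteq> I \<Longrightarrow> card J \<le> card (\<Union>(A ` J))"
  shows "\<exists>r. inj_on r I \<and> (\<forall>i\<in>I. r i \<in> A i)"
  using assms
proof (induction "card I" arbitrary: I A rule: less_induct)
  case less
  note fin = less.prems(1,2) and H = less.prems(3)
  have fU: "finite (\<Union>(A ` J))" if "J \<subseteq> I" for J
    using that fin finite_subset by blast
  consider "I = {}" | J where "J \<subseteq> I" "J \<noteq> {}" "J \<noteq> I" "card (\<Union>(A ` J)) = card J"
    | "I \<noteq> {}" "\<And>J. J \<subseteq> I \<Longrightarrow> J \<noteq> {} \<Longrightarrow> J \<noteq> I \<Longrightarrow> card J < card (\<Union>(A ` J))"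
    using H le_neq_implies_less by metis
  thus ?case
  proof cases
    case 1
    thus ?thesis by simp
  next
    case J: 2
    define A' where "A' = (\<lambda>i. A i - \<Union>(A ` J))"
    have finJ: "finite J" using J(1) fin(1) finite_subset by blast
    have "card J < card I" using J fin(1) by (simp add: psubset_card_mono psubset_eq)
    hence "\<exists>r. inj_on r J \<and> (\<forall>i\<in>J. r i \<in> A i)"
      using J(1) fin H finJ by (intro less.hyps) auto
    then obtain r1 where r1: "inj_on r1 J" "\<And>i. i \<in> J \<Longrightarrow> r1 i \<in> A i" by blast
    have "\<exists>r. inj_on r (I - J) \<and> (\<forall>i\<in>I - J. r i \<in> A' i)"
    proof (rule less.hyps)
      show "card (I - J) < card I" using J fin(1) by (intro psubset_card_mono) auto
      fix L assume L: "L \<subseteq> I - J"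
      \<comment> \<open>Hall's condition for \<open>L \<union> J\<close>, minus the exact count for
        \<open>J\<close>, is Hall's condition for \<open>L\<close> in the reduced sets.\<close>
      have "\<Union>(A' ` L) = \<Union>(A ` (L \<union> J)) - \<Union>(A ` J)" by (auto simp: A'_def)
      hence "card (\<Union>(A' ` L)) = card (\<Union>(A ` (L \<union> J))) - card (\<Union>(A ` J))"
        using fU[OF J(1)] by (simp add: card_Diff_subset image_Un)
      moreover have "card L + card J = card (L \<union> J)"
        using L finJ fin(1) finite_subset[of L I] by (subst card_Un_disjoint) auto
      moreover have "card (L \<union> J) \<le> card (\<Union>(A ` (L \<union> J)))" using H[of "L \<union> J"] L J(1) by auto
      ultimately show "card L \<le> card (\<Union>(A' ` L))" using J(4) by linarith
    qed (use fin in \<open>auto simp: A'_def\<close>)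
    then obtain r2 where r2: "inj_on r2 (I - J)" "\<And>i. i \<in> I - J \<Longrightarrow> r2 i \<in> A' i" by blast
    have sep: "r1 i \<noteq> r2 j" if "i \<in> J" "j \<in> I - J" for i j
      using r1(2)[OF that(1)] r2(2)[OF that(2)] that(1) by (auto simp: A'_def)
    have "inj_on (\<lambda>i. if i \<in> J then r1 i else r2 i) I"
      using inj_onD[OF r1(1)] inj_onD[OF r2(1)] sep sep[symmetric]
      by (intro inj_onI) (auto split: if_splits)
    moreover have "\<forall>i\<in>I. (if i \<in> J then r1 i else r2 i) \<in> A i"
      using r1(2) r2(2) by (auto simp: A'_def)
    ultimately show ?thesis by blast
  next
    case slack: 3
    then obtain i where i: "i \<in> I" by blast
    have "A i \<noteq> {}" using H[of "{i}"] i by auto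
    then obtain y where y: "y \<in> A i" by blast
    define A' where "A' = (\<lambda>j. A j - {y})"
    have "\<exists>r. inj_on r (I - {i}) \<and> (\<forall>j\<in>I - {i}. r j \<in> A' j)"
    proof (rule less.hyps)
      show "card (I - {i}) < card I" using i fin(1) by (intro psubset_card_mono) auto
      fix L assume L: "L \<subseteq> I - {i}"
      show "card L \<le> card (\<Union>(A' ` L))"
      proof (cases "L = {}")
        case False
        have "card L < card (\<Union>(A ` L))" using slack(2)[of L] L False i by blast
        moreover have "\<Union>(A' ` L) = \<Union>(A ` L) - {y}" by (auto simp: A'_def)
        hence "card (\<Union>(A ` L)) - 1 \<le> card (\<Union>(A' ` L))"
          by (simp add: diff_card_le_card_Diff[of "{y}", simplified])
        ultimately show ?thesis by linarith
      qed simp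
    qed (use fin in \<open>auto simp: A'_def\<close>)
    then obtain r where r: "inj_on r (I - {i})" "\<And>j. j \<in> I - {i} \<Longrightarrow> r j \<in> A' j" by blast
    have "inj_on (r(i := y)) I"
    proof (rule inj_onI)
      fix j k assume "j \<in> I" "k \<in> I" "(r(i := y)) j = (r(i := y)) k"
      thus "j = k"
        using r(2)[of j] r(2)[of k] inj_onD[OF r(1), of j k] by (auto simp: A'_def split: if_splits)
    qed
    moreover have "\<forall>j\<in>I. (r(i := y)) j \<in> A j" using r(2) y by (auto simp: A'_def)
    ultimately show ?thesis by blast
  qed
qed

context simple_graph
begin

text \<open>
  Take \<open>T\<close> of maximal size with \<open>card (odd_comps E (W - T)) = card T\<close>. Maximality and parity force all
  components of \<open>W - T\<close> to be odd and, by the induction hypothesis, factor-critical; Hall's theorem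
  assigns them to \<open>T\<close>.
\<close>

theorem tutte:
  assumes "finite W" "\<And>T. T \<subseteq> W \<Longrightarrow> card (odd_comps E (W - T)) \<le> card T"
  shows "matchable E W"
  using assms
proof (induction "card W" arbitrary: W rule: less_induct)
  case less
  note fin = less.prems(1) and le = less.prems(2)
  have finS: "finite Z" if "Z \<subseteq> W" for Z using that fin finite_subset by blast
  have par: "even (card (odd_comps E (W - T)) + card T)" if "T \<subseteq> W" for T
  proof -
    have "card (odd_comps E W) = 0" using le[of "{}"] by simp
    hence "even (card W)" using odd_comps_parity[OF fin] by simp
    moreover have "card W = card (W - T) + card T"
      using that finS[OF that] fin by (simp add: card_Diff_subset card_mono)
    ultimately show ?thesis using odd_comps_parity[of "W - T"] fin by simp
  qed
  define tight where "tight T \<longleftrightarrow> T \<subseteq> W \<and> card (odd_comps E (W - T)) = card T" for T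
  have "tight {}" using le[of "{}"] by (simp add: tight_def)
  moreover have "card T < Suc (card W)" if "tight T" for T
    using that card_mono[OF fin] by (auto simp: tight_def less_Suc_eq_le)
  ultimately obtain T where T: "tight T" and maxT: "\<And>T'. tight T' \<Longrightarrow> card T' \<le> card T"
    using ex_has_greatest_nat[of tight "{}" card "Suc (card W)"] by (metis less_or_eq_imp_le)
  have TW: "T \<subseteq> W" and cT: "card (odd_comps E (W - T)) = card T" using T by (auto simp: tight_def)
  note finT = finS[OF TW]
  have notight: "card (odd_comps E (W - (T \<union> Y))) < card T + card Y"
    if "Y \<subseteq> W - T" "Y \<noteq> {}" for Y
  proof -
    have c: "card (T \<union> Y) = card T + card Y"
      using that finS[of Y] finT by (intro card_Un_disjoint) auto
    have "card Y > 0" using that finS[of Y] by (auto simp: card_gt_0_iff)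
    hence "\<not> tight (T \<union> Y)" using maxT[of "T \<union> Y"] c by auto
    moreover have "T \<union> Y \<subseteq> W" using that(1) TW by blast
    ultimately show ?thesis using le[of "T \<union> Y"] c by (simp add: tight_def)
  qed
  \<comment> \<open>Deleting a vertex \<open>v\<close> from an even component leaves an odd number
    of vertices, hence at least one odd component, so \<open>T \<union> {v}\<close> would contradict
    \<open>notight\<close>.\<close>
  have odd: "C \<in> odd_comps E (W - T)" if C: "C \<in> comps E (W - T)" for C
  proof (rule ccontr)
    assume nC: "C \<notin> odd_comps E (W - T)"
    have CW: "C \<subseteq> W - T" "C \<noteq> {}" using C by (auto simp: comps_def)
    then obtain v where v: "v \<in> C" by blast
    have fC: "finite C" using CW finS by blast
    have "odd (card (C - {v}))"
      using C nC v fC card_Suc_Diff1[OF fC v] by (auto simp: odd_comps_def)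
    hence "odd (card (odd_comps E (C - {v})))" using odd_comps_parity[of "C - {v}"] fC by simp
    hence "card (odd_comps E (C - {v})) \<ge> 1" using odd_pos by fastforce
    moreover have "card (odd_comps E (W - T) - {C}) = card T" using nC cT by simp
    ultimately have "card T + 1 \<le> card (odd_comps E (W - T - {v}))"
      using odd_comps_delete(2)[of "W - T" C "{v}"] C v fin by simp
    moreover have "W - T - {v} = W - (T \<union> {v})" by blast
    ultimately show False using notight[of "{v}"] v CW by auto
  qed
  have crit: "matchable E (C - {v})" if C: "C \<in> odd_comps E (W - T)" and v: "v \<in> C" for C v
  proof (rule less.hyps)
    have C': "C \<in> comps E (W - T)" using C by (simp add: odd_comps_def)
    have CW: "C \<subseteq> W - T" using C' by (auto simp: comps_def)
    show "card (C - {v}) < card W" using CW v fin by (intro psubset_card_mono) auto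
    have fC: "finite C" using CW finS by blast
    thus "finite (C - {v})" by simp
    fix Y assume Y: "Y \<subseteq> C - {v}"
    have finY: "finite Y" and vY: "v \<notin> Y" using Y fC finite_subset by auto
    let ?Y = "insert v Y"
    have eq: "W - T - ?Y = W - (T \<union> ?Y)" "C - ?Y = C - {v} - Y" by auto
    have "card (odd_comps E (W - T) - {C}) + 1 = card T"
      using C cT finite_odd_comps[of "W - T"] fin card_Suc_Diff1[of "odd_comps E (W - T)" C] by simp
    moreover have "card (odd_comps E (W - T) - {C}) + card (odd_comps E (C - {v} - Y))
        \<le> card (odd_comps E (W - (T \<union> ?Y)))"
      using odd_comps_delete(2)[OF _ C', of ?Y, unfolded eq] Y v fin by blast
    moreover have "card (odd_comps E (W - (T \<union> ?Y))) < card T + card Y + 1"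
      using notight[of ?Y] Y v CW finY vY by auto
    moreover have "even (card (odd_comps E (C - {v} - Y)) + card Y)"
    proof -
      have "odd (card C)" using C by (simp add: odd_comps_def)
      moreover have "card C = card (C - {v} - Y) + card Y + 1"
      proof -
        have "card (C - {v} - Y) = card (C - {v}) - card Y" "card Y \<le> card (C - {v})"
          using Y fC finY by (auto simp: card_Diff_subset card_mono)
        thus ?thesis using card_Suc_Diff1[OF fC v] by linarith
      qed
      ultimately show ?thesis using odd_comps_parity[of "C - {v} - Y"] fC by simp
    qed
    \<comment> \<open>The preceding counts bound this number by \<open>card Y + 1\<close>; parity
      removes this last value.\<close>
    hence "card (odd_comps E (C - {v} - Y)) \<noteq> card Y + 1" by auto
    ultimately show "card (odd_comps E (C - {v} - Y)) \<le> card Y" by linarith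
  qed
  define N where "N C = {t \<in> T. \<exists>c\<in>C. E c t}" for C
  have "\<exists>r. inj_on r (odd_comps E (W - T)) \<and> (\<forall>C\<in>odd_comps E (W - T). r C \<in> N C)"
  proof (rule hall)
    show "finite (odd_comps E (W - T))" using fin by (simp add: finite_odd_comps)
    show "finite (N C)" for C using finT by (simp add: N_def)
    fix J assume J: "J \<subseteq> odd_comps E (W - T)"
    let ?N = "\<Union>(N ` J)"
    have NW: "?N \<subseteq> W" using TW by (auto simp: N_def)
    \<comment> \<open>The members of \<open>J\<close> have no neighbours in \<open>T\<close> outside
      \<open>?N\<close>, so they remain components when only \<open>?N\<close> is deleted, and the
      hypothesis for \<open>?N\<close> becomes Hall's condition for \<open>J\<close>.\<close>
    have "J \<subseteq> odd_comps E (W - ?N)"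
    proof
      fix C assume CJ: "C \<in> J"
      hence C: "C \<in> comps E (W - T)" "odd (card C)" using J by (auto simp: odd_comps_def)
      have cl: "closed_in E (W - T) Q" if "closed_in E (W - ?N) Q" for Q
        using that by (auto simp: closed_in_def N_def)
      have "closed_in E (W - ?N) C"
        unfolding closed_in_def
      proof (intro ballI impI)
        fix a b assume "a \<in> C" "b \<in> W - ?N" "E a b"
        thus "b \<in> C" using comps_closedD[OF C(1), of a b] CJ by (auto simp: N_def)
      qed
      thus "C \<in> odd_comps E (W - ?N)"
        using C cl by (auto simp: odd_comps_def comps_def N_def)
    qed
    hence "card J \<le> card (odd_comps E (W - ?N))"
      using fin by (intro card_mono finite_odd_comps) auto
    thus "card J \<le> card ?N" using le[OF NW] by linarith
  qed
  then obtain r where r: "inj_on r (odd_comps E (W - T))"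
      "\<And>C. C \<in> odd_comps E (W - T) \<Longrightarrow> r C \<in> N C" by blast
  have rT: "r ` odd_comps E (W - T) = T"
  proof (rule card_seteq[OF finT])
    show "r ` odd_comps E (W - T) \<subseteq> T" using r(2) by (auto simp: N_def)
    show "card T \<le> card (r ` odd_comps E (W - T))" using card_image[OF r(1)] cT by simp
  qed
  have "matchable E (\<Union>((\<lambda>C. insert (r C) C) ` odd_comps E (W - T)))"
  proof (rule matchable_Union)
    fix P assume "P \<in> (\<lambda>C. insert (r C) C) ` odd_comps E (W - T)"
    then obtain C where C: "C \<in> odd_comps E (W - T)" "P = insert (r C) C" by blast
    then obtain c where c: "c \<in> C" "E c (r C)" "r C \<in> T" using r(2)[OF C(1)] by (auto simp: N_def)
    have "r C \<notin> C" using c C by (auto simp: odd_comps_def comps_def)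
    moreover have "P = {c, r C} \<union> (C - {c})" using c C by auto
    ultimately show "matchable E P"
      using matchable_Un[OF matchable_pair[OF c(2)] crit[OF C(1) c(1)]] by auto
  next
    fix P Q assume PQ: "P \<in> (\<lambda>C. insert (r C) C) ` odd_comps E (W - T)"
      "Q \<in> (\<lambda>C. insert (r C) C) ` odd_comps E (W - T)" "P \<noteq> Q"
    then obtain C D where CD: "C \<in> odd_comps E (W - T)" "P = insert (r C) C"
      "D \<in> odd_comps E (W - T)" "Q = insert (r D) D" "C \<noteq> D" by blast
    have "C \<inter> D = {}" "C \<subseteq> W - T" "D \<subseteq> W - T"
      using CD comps_disjoint[of C "W - T" D] by (auto simp: odd_comps_def comps_def)
    moreover have "r C \<noteq> r D" "r C \<in> T" "r D \<in> T"
      using CD inj_onD[OF r(1), of C D] rT by auto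
    ultimately show "P \<inter> Q = {}" using CD by blast
  qed
  moreover have "\<Union>((\<lambda>C. insert (r C) C) ` odd_comps E (W - T)) = W"
  proof -
    have "\<Union>((\<lambda>C. insert (r C) C) ` odd_comps E (W - T))
        = r ` odd_comps E (W - T) \<union> \<Union>(odd_comps E (W - T))" by auto
    moreover have "odd_comps E (W - T) = comps E (W - T)" using odd by (auto simp: odd_comps_def)
    ultimately show ?thesis using rT Union_comps[of "W - T"] TW by auto
  qed
  ultimately show ?case by simp
qed

text \<open>If \<open>T\<close> violated Tutte's condition in \<open>K - {v}\<close>, parity would
  give at least \<open>card T + 2\<close> odd components there. Together with the
  \<open>card X - 1\<close> odd components other than \<open>K\<close> these are
  \<open>card X + card T + 1\<close>, so adding \<open>v\<close> and \<open>T\<close> to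
  \<open>X\<close> would give a tight set, against \<open>max\<close>.\<close>

lemma odd_comps_critical:
  assumes fin: "finite V" and V: "matchable E V" and XV: "X \<subseteq> V"
    and bar: "card (odd_comps E (V - X)) = card X"
    and max: "\<And>Y. Y \<noteq> {} \<Longrightarrow> Y \<subseteq> \<Union>(odd_comps E (V - X)) \<Longrightarrow>
        card (odd_comps E (V - (X \<union> Y))) \<noteq> card (X \<union> Y)"
    and K: "K \<in> odd_comps E (V - X)" and v: "v \<in> K"
  shows "matchable E (K - {v})"
proof (rule tutte)
  have K': "K \<in> comps E (V - X)" using K by (simp add: odd_comps_def)
  have KV: "K \<subseteq> V - X" using K' by (auto simp: comps_def)
  have fK: "finite K" using KV fin finite_subset by blast
  thus "finite (K - {v})" by simp
  fix T assume T: "T \<subseteq> K - {v}"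
  have finT: "finite T" and vT: "v \<notin> T" using T fK finite_subset by auto
  let ?Y = "insert v T"
  have eq: "V - X - ?Y = V - (X \<union> ?Y)" "K - ?Y = K - {v} - T" by auto
  have finX: "finite X" using XV fin finite_subset by blast
  have c: "card (X \<union> ?Y) = card X + card T + 1"
    using finX finT vT T v KV by (subst card_Un_disjoint) auto
  have "card (odd_comps E (V - X) - {K}) + 1 = card X"
    using K bar finite_odd_comps[of "V - X"] fin card_Suc_Diff1[of "odd_comps E (V - X)" K] by simp
  moreover have "card (odd_comps E (V - X) - {K}) + card (odd_comps E (K - {v} - T))
      \<le> card (odd_comps E (V - (X \<union> ?Y)))"
  proof -
    have "finite (V - X)" "?Y \<subseteq> K" using fin T v by auto
    from odd_comps_delete(2)[OF this(1) K' this(2)] show ?thesis by (simp only: eq)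
  qed
  moreover have "card (odd_comps E (V - (X \<union> ?Y))) \<le> card (X \<union> ?Y)"
    using card_odd_comps_le[OF fin V, of "X \<union> ?Y"] XV T v KV by auto
  moreover have "?Y \<subseteq> \<Union>(odd_comps E (V - X))" using K T v by blast
  hence "card (odd_comps E (V - (X \<union> ?Y))) \<noteq> card (X \<union> ?Y)" by (intro max) auto
  moreover have "even (card (odd_comps E (K - {v} - T)) + card T)"
  proof -
    have "odd (card K)" using K by (simp add: odd_comps_def)
    moreover have "card K = card (K - {v} - T) + card T + 1"
    proof -
      have "card (K - {v} - T) = card (K - {v}) - card T" "card T \<le> card (K - {v})"
        using T fK finT by (auto simp: card_Diff_subset card_mono)
      thus ?thesis using card_Suc_Diff1[OF fK v] by linarith
    qed
    ultimately show ?thesis using odd_comps_parity[of "K - {v} - T"] fK by simp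
  qed
  hence "card (odd_comps E (K - {v} - T)) \<noteq> card T + 1" by auto
  ultimately show "card (odd_comps E (K - {v} - T)) \<le> card T" using c by linarith
qed

text \<open>
  Follows the alternating path that starts at \<open>w\<close> until it enters \<open>H\<close>. Deleting its first two
  vertices \<open>w\<close> and \<open>f w\<close> turns the path from \<open>w\<close> into the one from \<open>g (f w)\<close>.
\<close>

lemma exchange:
  assumes "finite W" "pm E W f" "pm E (W - {s, w}) g"
    and "H \<subseteq> W" "f ` H \<subseteq> H" "s \<in> H" "w \<in> W - H"
  shows "\<exists>h\<in>H. matchable E (insert h (W - H - {w}))"
  using assms
proof (induction "card W" arbitrary: W w rule: less_induct)
  case less
  note f = less.prems(2) and g = less.prems(3) and H = less.prems(4,5) and s = less.prems(6)
    and w = less.prems(7)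
  define a where "a = f w"
  define b where "b = g a"
  have a: "a \<in> W" "f a = w" "a \<noteq> w" "E w a"
    using pmD[OF f, of w] pm_neq[OF f, of w] w by (auto simp: a_def)
  have aH: "a \<notin> H" using a(2) H w by auto
  hence a': "a \<in> W - {s, w}" using a s by auto
  have b: "b \<in> W - {s, w}" "g b = a" "b \<noteq> a" "E a b"
    using pmD[OF g a'] pm_neq[OF g a'] by (auto simp: b_def)
  show ?case
  proof (cases "b \<in> H")
    \<comment> \<open>The path enters \<open>H\<close> at \<open>b\<close>, which becomes
      \<open>h\<close>: the edge from \<open>a\<close> to \<open>b\<close> is used, and
      \<open>f\<close> pairs the vertices outside \<open>H\<close> other than \<open>w\<close> and
      \<open>a\<close>.\<close>
    case True
    have fH: "f x \<notin> H" if "x \<in> W - H" for x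
      using that H pmD(2)[OF f, of x] by force
    have "pm E (W - H) f"
      using fH pmD(1)[OF f] by (intro pm_restrict[OF f]) auto
    hence "pm E (W - H - {w, a}) f"
      using a w aH by (intro pm_restrict_Diff[of E "W - H"]) (auto simp: a_def)
    hence "matchable E (W - H - {w, a})" by (auto simp: matchable_def)
    moreover have "{a, b} \<inter> (W - H - {w, a}) = {}" using True by auto
    ultimately have "matchable E ({a, b} \<union> (W - H - {w, a}))"
      by (intro matchable_Un matchable_pair b(4))
    moreover have "{a, b} \<union> (W - H - {w, a}) = insert b (W - H - {w})" using a a' aH by auto
    ultimately show ?thesis using True by auto
  next
    case False
    let ?W = "W - {w, a}"
    have "pm E ?W f" using a w by (intro pm_restrict_Diff[OF f]) (auto simp: a_def)
    moreover have "pm E (W - {s, w} - {a, b}) g"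
      using a' b by (intro pm_restrict_Diff[OF g]) (auto simp: b_def)
    moreover have "W - {s, w} - {a, b} = ?W - {s, b}" by auto
    moreover have "card ?W < card W" using a less.prems(1) by (intro psubset_card_mono) auto
    ultimately obtain h where h: "h \<in> H" "matchable E (insert h (?W - H - {b}))"
      using less.hyps[of ?W b] less.prems(1) H s w aH b False by auto
    have "{a, b} \<inter> insert h (?W - H - {b}) = {}" using aH False h(1) by auto
    hence "matchable E ({a, b} \<union> insert h (?W - H - {b}))"
      by (intro matchable_Un matchable_pair b(4) h(2))
    moreover have "{a, b} \<union> insert h (?W - H - {b}) = insert h (W - H - {w})"
      using a' aH b False by auto
    ultimately show ?thesis using h(1) by auto
  qed
qed

text \<open>
  A maximal \<open>Q \<subseteq> D \<inter> A\<close> for which the statement holds inside \<open>Q \<union> f ` Q\<close> satisfies \<open>g ` f ` Q = Q\<close> for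
  every perfect matching \<open>g\<close>, so no allowed edge leaves \<open>Q \<union> f ` Q\<close>.
\<close>

lemma bipartite_elementary:
  assumes fin: "finite V" and D: "D \<in> comps (allowed E V) V"
    and bip: "\<And>u v. u \<in> V \<Longrightarrow> v \<in> V \<Longrightarrow> E u v \<Longrightarrow> u \<in> A \<longleftrightarrow> v \<notin> A"
    and V: "matchable E V" and a: "a \<in> D" "a \<in> A" and b: "b \<in> D" "b \<notin> A"
  shows "matchable E (D - {a, b})"
proof -
  interpret AE: simple_graph "allowed E V" by (rule allowed_simple_graph)
  obtain f where f: "pm E V f" using V by (auto simp: matchable_def)
  have DV: "D \<subseteq> V" and Dc: "closed_in (allowed E V) V D" using D by (auto simp: comps_def)
  have D_pm: "pm E D g" if "pm E V g" for g using pm_closed_allowed[OF that Dc DV] by simp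
  have finD: "finite D" using DV fin finite_subset by blast
  have side: "u \<in> A \<longleftrightarrow> g u \<notin> A" if "pm E V g" "u \<in> D" for g u
    using pmD[OF D_pm[OF that(1)] that(2)] bip[of u "g u"] DV that(2) by blast
  define P where "P Q \<longleftrightarrow> Q \<subseteq> D \<inter> A \<and> a \<in> Q \<and>
      (\<forall>b\<in>f ` Q. matchable E ((Q \<union> f ` Q) - {a, b}))" for Q
  \<comment> \<open>For \<open>Q = {a}\<close> the only \<open>b\<close> is \<open>f a\<close>, and
    nothing is left to be matched.\<close>
  have "P {a}" using a by (auto simp: P_def)
  moreover have "card Q < Suc (card D)" if "P Q" for Q
    using that card_mono[OF finD, of Q] by (auto simp: P_def less_Suc_eq_le)
  ultimately obtain Q where Q: "P Q" and maxQ: "\<And>Q'. P Q' \<Longrightarrow> card Q' \<le> card Q"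
    using ex_has_greatest_nat[of P "{a}" card "Suc (card D)"] by (metis less_or_eq_imp_le)
  have QD: "Q \<subseteq> D" "Q \<subseteq> A" "a \<in> Q" and Qm: "\<And>b. b \<in> f ` Q \<Longrightarrow> matchable E ((Q \<union> f ` Q) - {a, b})"
    using Q by (auto simp: P_def)
  have finQ: "finite Q" using QD finD finite_subset by blast
  have fQ: "f ` Q \<subseteq> D" "f ` Q \<inter> A = {}"
    using QD pmD(1)[OF D_pm[OF f]] side[OF f] by auto
  \<comment> \<open>If \<open>c\<close> were missing, \<open>insert c Q\<close> would also satisfy
    \<open>P\<close>, against maximality: for \<open>b' = f c\<close> the edge from \<open>b\<close>
    to \<open>c\<close> extends the matching that avoids \<open>a\<close> and \<open>b\<close>; for
    any other \<open>b'\<close> the edge from \<open>c\<close> to \<open>f c\<close> extends the one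
    that avoids \<open>a\<close> and \<open>b'\<close>.\<close>
  have nb: "c \<in> Q" if c: "c \<in> D" "c \<in> A" and b: "b \<in> f ` Q" and bc: "E b c" for b c
  proof (rule ccontr)
    assume cQ: "c \<notin> Q"
    define R where "R = Q \<union> f ` Q"
    have fc: "f c \<in> D" "f c \<notin> A" "E c (f c)" "f (f c) = c"
      using pmD[OF D_pm[OF f] c(1)] side[OF f c(1)] c by auto
    have fcQ: "f c \<notin> f ` Q" using pm_inj[OF f] cQ c(1) QD(1) DV by (auto dest: inj_onD)
    have cR: "c \<notin> R" "f c \<notin> R" "c \<noteq> f c" "a \<in> R"
      using cQ c(2) fQ fcQ fc(2) QD by (auto simp: R_def)
    have bR: "b \<in> R" "b \<noteq> a" using b fQ QD by (auto simp: R_def)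
    have R': "insert c Q \<union> f ` insert c Q = {c, f c} \<union> R" by (auto simp: R_def)
    have "matchable E (insert c Q \<union> f ` insert c Q - {a, b'})" if b': "b' \<in> f ` insert c Q" for b'
    proof (cases "b' = f c")
      case True
      have "matchable E ({b, c} \<union> (R - {a, b}))"
        using cR by (intro matchable_Un matchable_pair bc Qm[folded R_def] b) auto
      moreover have "{b, c} \<union> (R - {a, b}) = insert c Q \<union> f ` insert c Q - {a, b'}"
        unfolding R' True using cR bR by auto
      ultimately show ?thesis by simp
    next
      case False
      hence "b' \<in> f ` Q" using b' by auto
      hence "matchable E ({c, f c} \<union> (R - {a, b'}))"
        using cR by (intro matchable_Un matchable_pair fc(3) Qm[folded R_def]) auto
      moreover have "{c, f c} \<union> (R - {a, b'}) = insert c Q \<union> f ` insert c Q - {a, b'}"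
        unfolding R' using cR \<open>b' \<in> f ` Q\<close> by (auto simp: R_def)
      ultimately show ?thesis by simp
    qed
    hence "P (insert c Q)" using c QD unfolding P_def by blast
    thus False using maxQ cQ finQ by fastforce
  qed
  \<comment> \<open>By \<open>nb\<close> every perfect matching sends the \<open>f\<close>-partners
    of \<open>Q\<close> into \<open>Q\<close>; injectivity makes this onto.\<close>
  have img: "g ` f ` Q = Q" if g: "pm E V g" for g
  proof (rule card_seteq[OF finQ])
    show "g ` f ` Q \<subseteq> Q"
    proof
      fix c assume "c \<in> g ` f ` Q"
      then obtain b where b: "b \<in> f ` Q" "c = g b" by blast
      hence bD: "b \<in> D" "b \<notin> A" using fQ by auto
      show "c \<in> Q"
        using nb[of c b] b pmD[OF D_pm[OF g] bD(1)] side[OF g bD(1)] bD by auto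
    qed
    have "Q \<subseteq> V" "f ` Q \<subseteq> V" using QD fQ DV by auto
    hence "inj_on f Q" "inj_on g (f ` Q)"
      using inj_on_subset[OF pm_inj[OF f]] inj_on_subset[OF pm_inj[OF g]] by auto
    thus "card Q \<le> card (g ` f ` Q)" by (simp add: card_image)
  qed
  have "D \<subseteq> Q \<union> f ` Q"
  proof (rule AE.comps_minD[OF D a(1)])
    show "a \<in> Q \<union> f ` Q" using QD by simp
    fix u v assume u: "u \<in> Q \<union> f ` Q" "u \<in> D" and "allowed E V u v"
    then obtain g where g: "pm E V g" "g u = v" by (auto simp: allowed_def)
    show "v \<in> Q \<union> f ` Q"
    proof (cases "u \<in> f ` Q")
      case True
      thus ?thesis using img[OF g(1)] g(2) by blast
    next
      case False
      then obtain b where "b \<in> f ` Q" "u = g b" using u img[OF g(1)] by blast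
      thus ?thesis using g pmD(2)[OF g(1), of b] fQ(1) DV by auto
    qed
  qed
  hence D_eq: "Q \<union> f ` Q = D" using QD(1) fQ(1) by (intro equalityI Un_least)
  hence "b \<in> f ` Q" using QD(2) b by auto
  from Qm[OF this] show ?thesis unfolding D_eq .
qed

end

section \<open>Barriers with factor-critical odd components\<close>

text \<open>Adjacency between the blocks of a contraction; \<open>P \<noteq> Q\<close> accounts for
  the edges lost inside a block. It serves both \<open>G\<^sub>X\<close> and the contraction in the
  cathedral order.\<close>

definition qadj :: "('a \<Rightarrow> 'a \<Rightarrow> bool) \<Rightarrow> 'a set \<Rightarrow> 'a set \<Rightarrow> bool" where
  "qadj E P Q \<longleftrightarrow> P \<noteq> Q \<and> (\<exists>u\<in>P. \<exists>v\<in>Q. E u v)"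

text \<open>Factor-criticality of \<open>G[Z]/H\<close> written out in \<open>G\<close>: after
  deletion of \<open>w\<close>, the contracted vertex is matched along an edge at some
  \<open>h \<in> H\<close>. Deletion of the contracted vertex itself leaves \<open>Z - H\<close>,
  which any perfect matching of \<open>G\<close> matches, as \<open>Z\<close> and \<open>H\<close>
  are closed under allowed edges.\<close>

definition cath_le :: "('a \<Rightarrow> 'a \<Rightarrow> bool) \<Rightarrow> 'a set \<Rightarrow> 'a set \<Rightarrow> 'a set \<Rightarrow> bool" where
  "cath_le E V H H' \<longleftrightarrow> (\<exists>Z\<subseteq>V. closed_in (allowed E V) V Z \<and> H \<union> H' \<subseteq> Z \<and>
     (\<forall>w\<in>Z - H. \<exists>h\<in>H. matchable E (insert h (Z - H - {w}))))"

text \<open>This is \<open>U^*(H)\<close>; \<open>up_at\<close> below is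
  \<open>U(S)\<close>.\<close>

definition up :: "('a \<Rightarrow> 'a \<Rightarrow> bool) \<Rightarrow> 'a set \<Rightarrow> 'a set \<Rightarrow> 'a set" where
  "up E V H = \<Union>{H' \<in> comps (allowed E V) V. cath_le E V H H'}"

text \<open>\<open>H' \<noteq> H\<close> is implied by \<open>H' \<subseteq> L\<close>, as \<open>L\<close> is disjoint from \<open>H\<close>.\<close>

definition up_at :: "('a \<Rightarrow> 'a \<Rightarrow> bool) \<Rightarrow> 'a set \<Rightarrow> 'a set \<Rightarrow> 'a set \<Rightarrow> 'a set" where
  "up_at E V H S = \<Union>{H' \<in> comps (allowed E V) V. cath_le E V H H' \<and>
     (\<exists>L\<in>comps E (up E V H - H). {h \<in> H. \<exists>l\<in>L. E l h} \<subseteq> S \<and> H' \<subseteq> L)}"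

lemma (in simple_graph) pm_with_edge:
  assumes "E a b" "matchable E W" "a \<notin> W" "b \<notin> W"
  obtains g where "pm E ({a, b} \<union> W) g" "g a = b"
proof -
  obtain f where f: "pm E W f" using assms(2) by (auto simp: matchable_def)
  have "pm E ({a, b} \<union> W) (\<lambda>v. if v \<in> {a, b} then if v = a then b else a else f v)"
    using assms by (intro pm_Un pm_pair f) auto
  thus thesis by (rule that) simp
qed

text \<open>Odd-maximality is represented by its consequence \<open>crit\<close>; \<open>bar\<close>
  is the barrier condition, as the deficiency of a factorizable graph is zero.\<close>

locale barrier_graph = simple_graph E for E :: "'a \<Rightarrow> 'a \<Rightarrow> bool" +
  fixes V X :: "'a set"
  assumes fin: "finite V"
    and V_matchable: "matchable E V"
    and XV: "X \<subseteq> V"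
    and bar: "card (odd_comps E (V - X)) = card X"
    and crit: "K \<in> odd_comps E (V - X) \<Longrightarrow> v \<in> K \<Longrightarrow> matchable E (K - {v})"
begin

abbreviation "\<K> \<equiv> odd_comps E (V - X)"

text \<open>The vertices of \<open>G\<^sub>X\<close> are kept as blocks of \<open>V\<close>, in the
  form in which \<open>contract\<close> produces them; the even part of \<open>V\<close> is not
  covered by them.\<close>

definition "VB = (\<lambda>x. {x}) ` X \<union> \<K>"

definition "EB = qadj (\<lambda>u v. E u v \<and> \<not> (u \<in> X \<and> v \<in> X))"

lemma K_props:
  assumes "K \<in> \<K>"
  shows "K \<in> comps E (V - X)" "K \<subseteq> V" "K \<inter> X = {}" "K \<noteq> {}" "odd (card K)" "finite K"
    and "k \<in> K \<Longrightarrow> u \<in> V \<Longrightarrow> E k u \<Longrightarrow> u \<in> K \<union> X"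
proof -
  show K: "K \<in> comps E (V - X)" using assms by (simp add: odd_comps_def)
  thus KV: "K \<subseteq> V" "K \<inter> X = {}" "K \<noteq> {}" by (auto simp: comps_def)
  show "odd (card K)" using assms by (simp add: odd_comps_def)
  show "finite K" using KV fin finite_subset by blast
  show "k \<in> K \<Longrightarrow> u \<in> V \<Longrightarrow> E k u \<Longrightarrow> u \<in> K \<union> X"
    using comps_closedD[OF K, of k u] by blast
qed

lemma K_disjoint: "K \<in> \<K> \<Longrightarrow> L \<in> \<K> \<Longrightarrow> K \<noteq> L \<Longrightarrow> K \<inter> L = {}"
  using comps_disjoint[of K "V - X" L] by (simp add: odd_comps_def)

lemma finite_K: "finite \<K>"
  using fin by (simp add: finite_odd_comps)

lemma finite_X: "finite X"
  using fin XV finite_subset by blast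

lemma finite_VB: "finite VB"
  using finite_K finite_X by (simp add: VB_def)

lemma EB_simple_graph: "simple_graph EB"
proof
  show "EB P Q \<Longrightarrow> EB Q P" for P Q using sym by (auto simp: EB_def qadj_def)
  show "\<not> EB P P" for P by (simp add: EB_def qadj_def)
qed

lemma VB_disjoint: "P \<in> VB \<Longrightarrow> Q \<in> VB \<Longrightarrow> P \<noteq> Q \<Longrightarrow> P \<inter> Q = {}"
  using K_disjoint K_props(3) by (fastforce simp: VB_def)

lemma VB_subset: "P \<in> VB \<Longrightarrow> P \<subseteq> V"
  using K_props(2) XV by (auto simp: VB_def)

lemma single_notin_K: "x \<in> X \<Longrightarrow> {x} \<notin> \<K>"
  using K_props(3) by blast

text \<open>Distinct odd components are joined by no edge and edges inside \<open>X\<close> are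
  excluded from \<open>EB\<close>, so \<open>G\<^sub>X\<close> is bipartite. Each case also returns
  an edge of the original graph behind the contracted one.\<close>

lemma EB_cases:
  assumes "P \<in> VB" "Q \<in> VB" "EB P Q"
  obtains x k where "x \<in> X" "P = {x}" "Q \<in> \<K>" "k \<in> Q" "E x k"
  | x k where "x \<in> X" "Q = {x}" "P \<in> \<K>" "k \<in> P" "E x k"
proof -
  obtain u v where uv: "u \<in> P" "v \<in> Q" "E u v" "\<not> (u \<in> X \<and> v \<in> X)" "P \<noteq> Q"
    using assms(3) by (auto simp: EB_def qadj_def)
  have V: "u \<in> V" "v \<in> V" using uv assms VB_subset by auto
  show thesis
  proof (cases "u \<in> X")
    case True
    hence "Q \<in> \<K>" using uv assms(2) by (auto simp: VB_def)
    moreover have "P = {u}" using True uv(1) assms(1) K_props(3) by (auto simp: VB_def)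
    ultimately show thesis using that(1)[of u v] True uv by blast
  next
    case False
    hence P: "P \<in> \<K>" using uv assms(1) by (auto simp: VB_def)
    hence "v \<in> P \<union> X" using K_props(7)[OF P uv(1) V(2) uv(3)] by simp
    moreover have "v \<notin> P" using VB_disjoint[OF assms(1,2)] uv by blast
    ultimately have v: "v \<in> X" by blast
    hence "Q = {v}" using uv(2) assms(2) K_props(3) by (auto simp: VB_def)
    thus thesis using that(2)[of v u] v P uv sym by blast
  qed
qed

lemma EB_I: "x \<in> X \<Longrightarrow> K \<in> \<K> \<Longrightarrow> k \<in> K \<Longrightarrow> E x k \<Longrightarrow> EB {x} K"
  using K_props(3)[of K] by (auto simp: EB_def qadj_def)

text \<open>\<open>bar\<close> puts \<open>odd_family_matched\<close> into its tight case, with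
  \<open>T = X\<close> and all odd components as the family.\<close>

lemma pm_X:
  assumes f: "pm E V f"
  shows "x \<in> X \<Longrightarrow> \<exists>K\<in>\<K>. f x \<in> K" and "K \<in> \<K> \<Longrightarrow> \<exists>!k. k \<in> K \<and> f k \<in> X"
proof -
  have le: "card X \<le> card \<K>" by (simp add: bar)
  have sub: "K \<subseteq> V - X" if "K \<in> \<K>" for K using K_props(2,3)[OF that] by blast
  note * = K_disjoint sub K_props(5,7)
  show "x \<in> X \<Longrightarrow> \<exists>K\<in>\<K>. f x \<in> K"
    by (rule odd_family_matched(2)[OF fin f XV * le])
  show "K \<in> \<K> \<Longrightarrow> \<exists>!k. k \<in> K \<and> f k \<in> X"
    by (rule odd_family_matched(3)[OF fin f XV * le])
qed

lemma pm_K: "pm E V f \<Longrightarrow> K \<in> \<K> \<Longrightarrow> k \<in> K \<Longrightarrow> f k \<in> K \<union> X"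
  using K_props(7)[of K k "f k"] K_props(2)[of K] pmD[of E V f k] by blast

text \<open>Contraction turns a perfect matching of \<open>G\<close> into one of
  \<open>G\<^sub>X\<close>, because by \<open>pm_X\<close> exactly one of its edges joins a given
  odd component to \<open>X\<close>, and every vertex of \<open>X\<close> is used in this
  way.\<close>

lemma pm_quotient:
  assumes f: "pm E V f"
  obtains \<phi> where "pm EB VB \<phi>" "\<And>x. x \<in> X \<Longrightarrow> f x \<in> \<phi> {x}"
    "\<And>K k. K \<in> \<K> \<Longrightarrow> k \<in> K \<Longrightarrow> f k \<in> X \<Longrightarrow> \<phi> K = {f k}"
proof -
  obtain \<kappa> where \<kappa>: "\<And>x. x \<in> X \<Longrightarrow> \<kappa> x \<in> \<K> \<and> f x \<in> \<kappa> x" using pm_X(1)[OF f] by metis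
  obtain \<iota> where \<iota>: "\<And>K. K \<in> \<K> \<Longrightarrow> \<iota> K \<in> K \<and> f (\<iota> K) \<in> X" using pm_X(2)[OF f] by metis
  have \<iota>_unique: "\<iota> K = k" if "K \<in> \<K>" "k \<in> K" "f k \<in> X" for K k
    using that pm_X(2)[OF f that(1)] \<iota>[OF that(1)] by blast
  \<comment> \<open>\<open>\<iota> P\<close> is the vertex through which \<open>f\<close> leaves the
    odd component \<open>P\<close>, and \<open>\<kappa> x\<close> is the odd component containing
    \<open>f x\<close>.\<close>
  define \<phi> where "\<phi> P = (if P \<in> \<K> then {f (\<iota> P)} else \<kappa> (the_elem P))" for P
  have \<phi>X: "\<phi> {x} = \<kappa> x" if "x \<in> X" for x using single_notin_K[OF that] by (simp add: \<phi>_def)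
  have \<phi>K: "\<phi> K = {f k}" if "K \<in> \<K>" "k \<in> K" "f k \<in> X" for K k
    using \<iota>_unique[OF that] that by (simp add: \<phi>_def)
  have ff: "f (f v) = v" "E v (f v)" if "v \<in> V" for v using pmD[OF f that] by auto
  have "pm EB VB \<phi>"
    unfolding pm_def
  proof
    fix P assume "P \<in> VB"
    then consider x where "x \<in> X" "P = {x}" | "P \<in> \<K>" by (auto simp: VB_def)
    thus "\<phi> P \<in> VB \<and> \<phi> (\<phi> P) = P \<and> EB P (\<phi> P)"
    proof cases
      case (1 x)
      have x: "x \<in> V" using 1 XV by blast
      have "\<phi> (\<kappa> x) = {f (f x)}" using \<kappa>[OF 1(1)] ff(1)[OF x] 1 by (intro \<phi>K) auto
      moreover have "EB {x} (\<kappa> x)" using \<kappa>[OF 1(1)] ff(2)[OF x] 1(1) by (intro EB_I) auto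
      ultimately show ?thesis using 1 \<phi>X \<kappa>[OF 1(1)] ff(1)[OF x] by (auto simp: VB_def)
    next
      case 2
      define x where "x = f (\<iota> P)"
      have \<iota>P: "\<iota> P \<in> P" "x \<in> X" "\<iota> P \<in> V" using \<iota>[OF 2] K_props(2)[OF 2] by (auto simp: x_def)
      have fx: "f x = \<iota> P" using ff(1)[OF \<iota>P(3)] by (simp add: x_def)
      have "\<kappa> x = P" using \<kappa>[OF \<iota>P(2)] fx \<iota>P(1) K_disjoint[OF 2, of "\<kappa> x"] by auto
      moreover have "\<phi> P = {x}" using 2 by (simp add: \<phi>_def x_def)
      moreover have "EB {x} P"
        using ff(2)[OF \<iota>P(3)] sym by (intro EB_I[OF \<iota>P(2) 2 \<iota>P(1)]) (auto simp: x_def)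
      hence "EB P {x}" by (rule simple_graph.sym[OF EB_simple_graph])
      ultimately show ?thesis using \<phi>X \<iota>P(2) by (auto simp: VB_def)
    qed
  qed
  thus thesis using that \<phi>X \<phi>K \<kappa> by auto
qed

text \<open>The lifting step: a matched pair of \<open>{x}\<close> and \<open>K\<close> comes from
  an edge from \<open>x\<close> to some \<open>k \<in> K\<close>, and \<open>crit\<close> matches
  the rest of \<open>K\<close>.\<close>

lemma matchable_Union_quotient:
  assumes "Q \<subseteq> VB" "matchable EB Q"
  shows "matchable E (\<Union>Q)"
proof -
  obtain \<phi> where \<phi>: "pm EB Q \<phi>" using assms(2) by (auto simp: matchable_def)
  note D = pmD[OF \<phi>]
  \<comment> \<open>\<open>P\<close> and its partner \<open>\<phi> P\<close> yield the same union,
    so the image has one block per matching edge.\<close>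
  have "matchable E (\<Union>((\<lambda>P. P \<union> \<phi> P) ` Q))"
  proof (rule matchable_Union)
    fix R assume "R \<in> (\<lambda>P. P \<union> \<phi> P) ` Q"
    then obtain P where P: "P \<in> Q" "R = P \<union> \<phi> P" by blast
    have *: "matchable E ({x} \<union> K)" if "x \<in> X" "K \<in> \<K>" "k \<in> K" "E x k" for x K k
    proof -
      have "matchable E ({x, k} \<union> (K - {k}))"
        using that K_props(3)[OF that(2)] by (intro matchable_Un matchable_pair crit) auto
      moreover have "{x, k} \<union> (K - {k}) = {x} \<union> K" using that by blast
      ultimately show ?thesis by simp
    qed
    have "P \<in> VB" "\<phi> P \<in> VB" "EB P (\<phi> P)" using D[OF P(1)] P(1) assms(1) by auto
    thus "matchable E R"
    proof (cases rule: EB_cases)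
      case (1 x k)
      thus ?thesis using *[of x "\<phi> P" k] P(2) by simp
    next
      case (2 x k)
      thus ?thesis using *[of x P k] P(2) by (simp add: Un_commute)
    qed
  next
    fix R R' assume "R \<in> (\<lambda>P. P \<union> \<phi> P) ` Q" "R' \<in> (\<lambda>P. P \<union> \<phi> P) ` Q" "R \<noteq> R'"
    then obtain P P' where P: "P \<in> Q" "R = P \<union> \<phi> P" "P' \<in> Q" "R' = P' \<union> \<phi> P'" by blast
    have neq: "P \<noteq> P'" "P \<noteq> \<phi> P'" "\<phi> P \<noteq> P'" "\<phi> P \<noteq> \<phi> P'"
      using P(2,4) \<open>R \<noteq> R'\<close> D(2)[OF P(1)] D(2)[OF P(3)] Un_commute by metis+
    have "P \<in> VB" "\<phi> P \<in> VB" "P' \<in> VB" "\<phi> P' \<in> VB" using P D(1) assms(1) by auto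
    hence "P \<inter> P' = {}" "P \<inter> \<phi> P' = {}" "\<phi> P \<inter> P' = {}" "\<phi> P \<inter> \<phi> P' = {}"
      using neq VB_disjoint by simp_all
    thus "R \<inter> R' = {}" using P(2,4) by blast
  qed
  moreover have "\<Union>((\<lambda>P. P \<union> \<phi> P) ` Q) = \<Union>Q" using D(1) by blast
  ultimately show ?thesis by simp
qed

text \<open>A perfect matching sends all of \<open>X\<close> to odd components, and odd components
  only to themselves and \<open>X\<close>, so it preserves the remaining vertices.\<close>

lemma matchable_even_part: "matchable E (V - \<Union>VB)"
proof -
  obtain f where f: "pm E V f" using V_matchable by (auto simp: matchable_def)
  have "pm E (V - \<Union>VB) f"
  proof (rule pm_restrict[OF f])
    fix v assume v: "v \<in> V - \<Union>VB"
    have vX: "v \<notin> X" and vK: "\<And>K. K \<in> \<K> \<Longrightarrow> v \<notin> K" using v by (auto simp: VB_def)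
    note d = pmD[OF f, of v]
    have "f v \<notin> X" using pm_X(1)[OF f, of "f v"] d v vK by auto
    moreover have "f v \<notin> K" if "K \<in> \<K>" for K
      using pm_K[OF f that, of "f v"] d v vX vK[OF that] by auto
    ultimately show "f v \<in> V - \<Union>VB" using d v by (auto simp: VB_def)
  qed auto
  thus ?thesis by (auto simp: matchable_def)
qed

text \<open>A perfect matching of \<open>G\<close> through an edge from \<open>x\<close> to
  \<open>k\<close> is assembled from the lifted rest of a matching of \<open>G\<^sub>X\<close>, the
  even part and \<open>K - {k}\<close>. The end \<open>k\<close> may be any neighbour of
  \<open>x\<close> in \<open>K\<close>.\<close>

lemma allowed_quotientD:
  assumes "allowed EB VB {x} K" "x \<in> X" "K \<in> \<K>"
  shows "\<exists>k\<in>K. allowed E V x k"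
proof -
  interpret B: simple_graph EB by (rule EB_simple_graph)
  obtain \<phi> where \<phi>: "pm EB VB \<phi>" "\<phi> {x} = K" using assms(1) by (auto simp: allowed_def)
  have x: "{x} \<in> VB" "K \<in> VB" using assms by (auto simp: VB_def)
  have "EB {x} K" "\<phi> K = {x}" using pmD[OF \<phi>(1) x(1)] \<phi>(2) by auto
  obtain k where k: "k \<in> K" "E x k"
  proof (cases rule: EB_cases[OF x \<open>EB {x} K\<close>])
    case (1 y k)
    thus ?thesis using that by auto
  next
    case (2 y k)
    thus ?thesis using assms single_notin_K by blast
  qed
  have "pm EB (VB - {{x}, K}) \<phi>"
    using \<phi> \<open>\<phi> K = {x}\<close> x by (intro pm_restrict_Diff[OF \<phi>(1)]) auto
  hence "matchable E (\<Union>(VB - {{x}, K}))" by (intro matchable_Union_quotient) (auto simp: matchable_def)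
  moreover have disj: "P \<inter> ({x} \<union> K) = {}" if "P \<in> VB - {{x}, K}" for P
    using VB_disjoint[OF _ x(1), of P] VB_disjoint[OF _ x(2), of P] that by blast
  ultimately have "matchable E (\<Union>(VB - {{x}, K}) \<union> (V - \<Union>VB) \<union> (K - {k}))"
    using crit[OF assms(3) k(1)] x by (intro matchable_Un matchable_even_part) blast+
  then obtain g where g: "pm E ({x, k} \<union> (\<Union>(VB - {{x}, K}) \<union> (V - \<Union>VB) \<union> (K - {k}))) g" "g x = k"
  proof (rule pm_with_edge[OF k(2)])
    show "x \<notin> \<Union>(VB - {{x}, K}) \<union> (V - \<Union>VB) \<union> (K - {k})"
      using disj x K_props(3)[OF assms(3)] assms(2) by blast
    show "k \<notin> \<Union>(VB - {{x}, K}) \<union> (V - \<Union>VB) \<union> (K - {k})" using disj x k by blast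
  qed
  have "{x, k} \<union> (\<Union>(VB - {{x}, K}) \<union> (V - \<Union>VB) \<union> (K - {k})) = V"
    using x k VB_subset by blast
  thus ?thesis using g k XV assms(2) unfolding allowed_def by auto
qed

end

section \<open>The vertex set \<open>Vh\<close> of the expansion of one DM-component\<close>

locale DM_component = barrier_graph +
  fixes D :: "'a set set"
  assumes D: "D \<in> comps (allowed EB VB) VB"
begin

definition "Vh = \<Union>D"

definition "S = X \<inter> Vh"

sublocale B: simple_graph EB by (rule EB_simple_graph)

sublocale BA: simple_graph "allowed EB VB" by (rule B.allowed_simple_graph)

lemma D_VB: "D \<subseteq> VB"
  using D by (simp add: comps_def)

lemma D_pm: "pm EB VB \<phi> \<Longrightarrow> pm EB D \<phi>"
  using B.pm_closed_allowed(1) D by (auto simp: comps_def)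

lemma in_Vh: "v \<in> P \<Longrightarrow> P \<in> VB \<Longrightarrow> v \<in> Vh \<longleftrightarrow> P \<in> D"
  using VB_disjoint[of P] D_VB unfolding Vh_def by blast

lemma S_iff: "x \<in> S \<longleftrightarrow> x \<in> X \<and> {x} \<in> D"
  using in_Vh[of x "{x}"] by (auto simp: S_def VB_def)

lemma Vh_V: "Vh \<subseteq> V"
  using D_VB VB_subset by (auto simp: Vh_def)

lemma Vh_cases:
  assumes "v \<in> Vh" "v \<notin> S"
  obtains K where "K \<in> D" "K \<in> \<K>" "v \<in> K"
  using assms D_VB by (auto simp: Vh_def S_def VB_def)

lemma K_Vh: "K \<in> D \<Longrightarrow> K \<subseteq> Vh"
  by (auto simp: Vh_def)

text \<open>By \<open>pm_quotient\<close> a matching edge at \<open>X\<close> projects to an allowed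
  edge of \<open>G\<^sub>X\<close>, which cannot leave \<open>D\<close>; any other matching edge at
  an odd component stays inside it.\<close>

lemma Vh_closed: "closed_in (allowed E V) V Vh"
  unfolding closed_in_def
proof (intro ballI impI)
  fix u v assume u: "u \<in> Vh" and "allowed E V u v"
  then obtain f where f: "pm E V f" "f u = v" "u \<in> V" by (auto simp: allowed_def)
  obtain \<phi> where \<phi>: "pm EB VB \<phi>" "\<And>x. x \<in> X \<Longrightarrow> f x \<in> \<phi> {x}"
    "\<And>K k. K \<in> \<K> \<Longrightarrow> k \<in> K \<Longrightarrow> f k \<in> X \<Longrightarrow> \<phi> K = {f k}"
    using pm_quotient[OF f(1)] by blast
  show "v \<in> Vh"
  proof (cases "u \<in> S")
    case True
    hence "\<phi> {u} \<in> D" "u \<in> X" using pmD(1)[OF D_pm[OF \<phi>(1)], of "{u}"] by (auto simp: S_iff)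
    thus ?thesis using \<phi>(2)[of u] f(2) by (auto simp: Vh_def)
  next
    case False
    then obtain K where K: "K \<in> D" "K \<in> \<K>" "u \<in> K" using u Vh_cases by blast
    show ?thesis
    proof (cases "v \<in> X")
      case True
      hence "{v} \<in> D" using \<phi>(3)[OF K(2,3)] pmD(1)[OF D_pm[OF \<phi>(1)] K(1)] f(2) by simp
      thus ?thesis by (auto simp: Vh_def)
    next
      case False
      thus ?thesis using pm_K[OF f(1) K(2,3)] f(2) K_Vh[OF K(1)] by auto
    qed
  qed
qed

lemma pm_Vh: "pm E V f \<Longrightarrow> pm E Vh f" "pm E V f \<Longrightarrow> pm E (V - Vh) f"
  using pm_closed_allowed[OF _ Vh_closed Vh_V] by blast+

lemma ex_quotient_pm: "\<exists>\<phi>. pm EB VB \<phi>"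
proof -
  obtain f where "pm E V f" using V_matchable by (auto simp: matchable_def)
  thus ?thesis by (rule pm_quotient) blast
qed

lemma EB_bip: "P \<in> VB \<Longrightarrow> Q \<in> VB \<Longrightarrow> EB P Q \<Longrightarrow> P \<in> \<K> \<longleftrightarrow> Q \<notin> \<K>"
  by (erule (2) EB_cases) (auto dest: single_notin_K)

text \<open>\<open>bipartite_elementary\<close> matches \<open>D\<close> without \<open>K\<close>
  and \<open>{s}\<close>; lifting this and adding a matching of \<open>K - {w}\<close> from
  \<open>crit\<close> leaves out exactly \<open>s\<close> and \<open>w\<close>.\<close>

lemma matchable_Vh_minus:
  assumes "s \<in> S" "K \<in> D" "K \<in> \<K>" "w \<in> K"
  shows "matchable E (Vh - {s, w})"
proof -
  have s: "{s} \<in> D" "s \<in> X" using assms(1) by (auto simp: S_iff)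
  have "matchable EB (D - {K, {s}})"
    using EB_bip ex_quotient_pm s single_notin_K assms
    by (intro B.bipartite_elementary[OF finite_VB D, of \<K>]) (auto simp: matchable_def)
  hence "matchable E (\<Union>(D - {K, {s}}))" using D_VB by (intro matchable_Union_quotient) auto
  moreover have disj: "P \<inter> ({s} \<union> K) = {}" if "P \<in> D - {K, {s}}" for P
    using VB_disjoint[of P K] VB_disjoint[of P "{s}"] that D_VB assms(2) s(1) by blast
  ultimately have "matchable E (\<Union>(D - {K, {s}}) \<union> (K - {w}))"
    using crit[OF assms(3,4)] by (intro matchable_Un) blast+
  moreover have "\<Union>(D - {K, {s}}) \<union> (K - {w}) = Vh - {s, w}"
    unfolding Vh_def using disj K_props(3)[OF assms(3)] s assms by blast
  ultimately show ?thesis by simp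
qed

text \<open>A perfect matching of \<open>G\<^sub>X\<close> restricts to \<open>D\<close> and swaps
  its two colour classes.\<close>

lemma card_D_K: "card (D \<inter> \<K>) = card S"
proof -
  obtain \<phi> where \<phi>: "pm EB VB \<phi>" using ex_quotient_pm by blast
  note d = pmD[OF D_pm[OF \<phi>]]
  have "bij_betw \<phi> (D \<inter> \<K>) (D - \<K>)"
  proof (rule bij_betw_byWitness[where f' = \<phi>])
    show "\<phi> ` (D \<inter> \<K>) \<subseteq> D - \<K>" "\<phi> ` (D - \<K>) \<subseteq> D \<inter> \<K>"
      using d EB_bip D_VB by blast+
  qed (use d in auto)
  moreover have "D - \<K> = (\<lambda>x. {x}) ` S"
    using D_VB single_notin_K by (auto simp: S_iff VB_def)
  ultimately have "card (D \<inter> \<K>) = card ((\<lambda>x. {x}) ` S)" using bij_betw_same_card by metis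
  thus ?thesis by (simp add: card_image)
qed

lemma S_nonempty: "S \<noteq> {}"
proof
  assume "S = {}"
  obtain P where P: "P \<in> D" using D by (auto simp: comps_def)
  obtain \<phi> where \<phi>: "pm EB VB \<phi>" using ex_quotient_pm by blast
  note d = pmD[OF D_pm[OF \<phi>] P]
  have "P \<in> VB" "\<phi> P \<in> VB" using P d(1) D_VB by auto
  thus False
    by (rule EB_cases[OF _ _ d(3)]) (use P d(1) \<open>S = {}\<close> S_iff in auto)
qed

end

section \<open>The factor-component of a DM-component\<close>

text \<open>\<open>H\<close> is only assumed to meet \<open>S\<close>; \<open>S_H\<close>
  strengthens this to containment, so every vertex of \<open>S\<close> determines the same
  \<open>H\<close>.\<close>

locale DM_factor = DM_component +
  fixes H :: "'a set"
  assumes H: "H \<in> comps (allowed E V) V"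
    and H_S: "H \<inter> S \<noteq> {}"
begin

sublocale AE: simple_graph "allowed E V" by (rule allowed_simple_graph)

lemma H_V: "H \<subseteq> V"
  using H by (simp add: comps_def)

lemma H_closed: "closed_in (allowed E V) V H"
  using H by (simp add: comps_def)

lemma pm_H: "pm E V f \<Longrightarrow> v \<in> H \<Longrightarrow> f v \<in> H"
  using pmD(1)[OF pm_closed_allowed(1)[OF _ H_closed H_V]] by blast

lemma H_Vh: "H \<subseteq> Vh"
proof -
  obtain s where s: "s \<in> H" "s \<in> Vh" using H_S by (auto simp: S_def)
  show ?thesis
  proof (rule AE.comps_minD[OF H s])
    show "b \<in> Vh" if "a \<in> Vh" "allowed E V a b" for a b
      using that Vh_closed allowed_in[OF that(2)] by (auto simp: closed_in_def)
  qed
qed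

text \<open>
  In every perfect matching exactly one vertex of \<open>K\<close> is matched to \<open>X\<close>, and the other vertices
  of \<open>K \<inter> H\<close> are matched among themselves.
\<close>

lemma odd_Int_H:
  assumes f: "pm E V f" and K: "K \<in> \<K>" "k \<in> K" "f k \<in> X"
  shows "odd (card (K \<inter> H)) \<longleftrightarrow> k \<in> H"
proof -
  have unique: "v = k" if "v \<in> K" "f v \<in> X" for v using pm_X(2)[OF f K(1)] K that by blast
  have "pm E (K \<inter> H - {k}) f"
  proof (rule pm_restrict[OF f])
    show "K \<inter> H - {k} \<subseteq> V" using H_V by blast
    fix v assume v: "v \<in> K \<inter> H - {k}"
    have "f v \<notin> X" using unique v by blast
    moreover have "f v \<noteq> k" using pmD(2)[OF f, of v] v H_V K K_props(3)[OF K(1)] calculation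
      by (metis DiffD1 IntE disjoint_iff subsetD unique)
    ultimately show "f v \<in> K \<inter> H - {k}"
      using pm_K[OF f K(1), of v] pm_H[OF f, of v] v by blast
  qed
  moreover have fin': "finite (K \<inter> H)" using K_props(6)[OF K(1)] by simp
  ultimately have even: "even (card (K \<inter> H - {k}))" by (intro pm_even) auto
  show ?thesis
  proof (cases "k \<in> H")
    case True
    hence "card (K \<inter> H) = Suc (card (K \<inter> H - {k}))"
      using K(2) fin' by (intro card_Suc_Diff1[symmetric]) auto
    thus ?thesis using even True by simp
  next
    case False
    thus ?thesis using even by simp
  qed
qed

text \<open>Membership in \<open>H\<close> is propagated through \<open>D\<close> along allowed
  edges: for \<open>{x}\<close> it means \<open>x \<in> H\<close>, for an odd component
  \<open>K\<close> that \<open>K \<inter> H\<close> is odd. The vertex through which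
  \<open>K\<close> is left varies with the matching, but by \<open>odd_Int_H\<close> this parity
  alone decides whether it lies in \<open>H\<close>.\<close>

lemma S_H: "S \<subseteq> H" and K_meets_H: "K \<in> D \<Longrightarrow> K \<in> \<K> \<Longrightarrow> K \<inter> H \<noteq> {}"
proof -
  define Q where "Q = {P. (\<exists>x\<in>X \<inter> H. P = {x}) \<or> (P \<in> \<K> \<and> odd (card (P \<inter> H)))}"
  obtain s where s: "s \<in> S" "s \<in> H" using H_S by blast
  have "D \<subseteq> Q"
  proof (rule BA.comps_minD[OF D])
    show "{s} \<in> D" "{s} \<in> Q" using s by (auto simp: S_iff Q_def)
    fix P P' assume P: "P \<in> D" "P \<in> Q" "P' \<in> D" "allowed EB VB P P'"
    have VB: "P \<in> VB" "P' \<in> VB" "EB P P'" using B.allowed_in[OF P(4)] by auto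
    show "P' \<in> Q"
    proof (cases rule: EB_cases[OF VB])
      case (1 x k)
      obtain k' where k': "k' \<in> P'" "allowed E V x k'"
        using allowed_quotientD[of x P'] P(4) 1 by auto
      then obtain f where f: "pm E V f" "x \<in> V" "f x = k'" by (auto simp: allowed_def)
      have "f k' = x" using pmD(2)[OF f(1,2)] f(3) by simp
      have "x \<in> H" using P(2) 1 single_notin_K by (auto simp: Q_def)
      hence "k' \<in> H" using pm_H[OF f(1)] f(3) by blast
      thus ?thesis
        using odd_Int_H[OF f(1) 1(3) k'(1)] \<open>f k' = x\<close> 1 by (auto simp: Q_def)
    next
      case (2 x k)
      obtain k' where k': "k' \<in> P" "allowed E V x k'"
        using allowed_quotientD[of x P] BA.sym B.allowed_simple_graph P(4) 2 simple_graph.sym by blast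
      then obtain f where f: "pm E V f" "x \<in> V" "f x = k'" by (auto simp: allowed_def)
      have fk: "f k' = x" using pmD(2)[OF f(1,2)] f(3) by simp
      have "odd (card (P \<inter> H))" using P(2) 2 single_notin_K by (auto simp: Q_def)
      hence "k' \<in> H" using odd_Int_H[OF f(1) 2(3) k'(1)] fk 2(1) by simp
      hence "x \<in> H" using pm_H[OF f(1)] fk by metis
      thus ?thesis using 2 by (auto simp: Q_def)
    qed
  qed
  thus "S \<subseteq> H" using single_notin_K by (auto simp: S_iff Q_def)
  assume "K \<in> D" "K \<in> \<K>"
  hence "odd (card (K \<inter> H))" using \<open>D \<subseteq> Q\<close> single_notin_K by (auto simp: Q_def)
  thus "K \<inter> H \<noteq> {}" by auto
qed

lemma X_Int_H: "X \<inter> H = S"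
  using S_H H_Vh by (auto simp: S_def)

text \<open>For \<open>v\<close> outside \<open>S\<close>, matchings of \<open>V - Vh\<close> and
  \<open>Vh - {s, v}\<close> combine. For \<open>v\<close> in \<open>S\<close>, the odd components
  of \<open>V - X\<close> survive the deletion while \<open>X\<close> shrinks, which violates
  Tutte's condition; this covers \<open>v = s\<close> too.\<close>

lemma canonical_class:
  assumes "s \<in> S"
  shows "{v \<in> H. \<not> matchable E (V - {s, v})} = S"
proof (intro set_eqI iffI)
  fix v assume v: "v \<in> {v \<in> H. \<not> matchable E (V - {s, v})}"
  show "v \<in> S"
  proof (rule ccontr)
    assume "v \<notin> S"
    then obtain K where K: "K \<in> D" "K \<in> \<K>" "v \<in> K" using v H_Vh Vh_cases by blast
    have "matchable E (V - Vh)" using V_matchable pm_Vh(2) unfolding matchable_def by blast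
    hence "matchable E ((V - Vh) \<union> (Vh - {s, v}))"
      using matchable_Vh_minus[OF assms K] by (intro matchable_Un) auto
    moreover have "(V - Vh) \<union> (Vh - {s, v}) = V - {s, v}"
      using Vh_V v H_Vh assms by (auto simp: S_def)
    ultimately show False using v by simp
  qed
next
  fix v assume v: "v \<in> S"
  have X: "s \<in> X" "v \<in> X" using assms v by (auto simp: S_def)
  have "\<not> matchable E (V - {s, v})"
  proof
    assume "matchable E (V - {s, v})"
    hence "card (odd_comps E (V - {s, v} - (X - {s, v}))) \<le> card (X - {s, v})"
      using fin XV by (intro card_odd_comps_le) auto
    moreover have "V - {s, v} - (X - {s, v}) = V - X" using X by blast
    moreover have "card (X - {s, v}) < card X" using X finite_X by (intro psubset_card_mono) auto
    ultimately show False using bar by simp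
  qed
  thus "v \<in> {v \<in> H. \<not> matchable E (V - {s, v})}" using v S_H by blast
qed

lemma cath_le_Vh:
  assumes "H' \<subseteq> Vh"
  shows "cath_le E V H H'"
  unfolding cath_le_def
proof (intro exI conjI ballI)
  fix w assume w: "w \<in> Vh - H"
  then obtain K where K: "K \<in> D" "K \<in> \<K>" "w \<in> K" using S_H Vh_cases by blast
  obtain s where s: "s \<in> S" using S_nonempty by blast
  obtain f where f: "pm E V f" using V_matchable by (auto simp: matchable_def)
  obtain g where g: "pm E (Vh - {s, w}) g"
    using matchable_Vh_minus[OF s K] by (auto simp: matchable_def)
  show "\<exists>h\<in>H. matchable E (insert h (Vh - H - {w}))"
  proof (rule exchange[OF _ pm_Vh(1)[OF f] g H_Vh])
    show "finite Vh" using Vh_V fin finite_subset by blast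
    show "f ` H \<subseteq> H" using pm_H[OF f] by blast
  qed (use s S_H w in auto)
qed (use assms H_Vh Vh_V Vh_closed in auto)

lemma ex_factor_comp:
  assumes "v \<in> V"
  obtains H' where "H' \<in> comps (allowed E V) V" "v \<in> H'"
  using AE.ex_comp[OF assms] by blast

lemma factor_comp_Vh:
  assumes "H' \<in> comps (allowed E V) V" "v \<in> H'" "v \<in> Vh"
  shows "H' \<subseteq> Vh"
proof (rule AE.comps_minD[OF assms])
  show "b \<in> Vh" if "a \<in> Vh" "allowed E V a b" for a b
    using that Vh_closed allowed_in[OF that(2)] by (auto simp: closed_in_def)
qed

lemma Vh_up: "Vh \<subseteq> up E V H"
proof
  fix v assume v: "v \<in> Vh"
  obtain H' where H': "H' \<in> comps (allowed E V) V" "v \<in> H'" using v Vh_V ex_factor_comp by blast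
  have "cath_le E V H H'" using factor_comp_Vh[OF H' v] by (rule cath_le_Vh)
  thus "v \<in> up E V H" using H' by (auto simp: up_def)
qed

lemma Vh_not_up_at: "Vh \<inter> up_at E V H S = {}"
proof (rule ccontr)
  assume "Vh \<inter> up_at E V H S \<noteq> {}"
  then obtain w L where w: "w \<in> Vh" "w \<in> L" and L: "L \<in> comps E (up E V H - H)"
    and nb: "{h \<in> H. \<exists>l\<in>L. E l h} \<subseteq> S" unfolding up_at_def by blast
  have LH: "L \<subseteq> up E V H - H" using L by (simp add: comps_def)
  obtain K where K: "K \<in> D" "K \<in> \<K>" "w \<in> K" using w LH S_H Vh_cases by blast
  \<comment> \<open>A walk inside \<open>K\<close> starting in \<open>L\<close> could leave
    \<open>L\<close> only by entering \<open>H\<close>, hence \<open>S\<close> by \<open>nb\<close>;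
    but \<open>S\<close> is part of \<open>X\<close>, which \<open>K\<close> avoids.\<close>
  have "K \<subseteq> L"
  proof (rule comps_minD[OF K_props(1)[OF K(2)] K(3) w(2)])
    fix a b assume ab: "a \<in> K" "a \<in> L" "b \<in> K" "E a b"
    have "b \<notin> H"
    proof
      assume "b \<in> H"
      hence "b \<in> S" using nb ab by blast
      thus False using ab(3) K_props(3)[OF K(2)] by (auto simp: S_def)
    qed
    moreover have "b \<in> up E V H" using ab(3) K_Vh[OF K(1)] Vh_up by blast
    ultimately show "b \<in> L" using comps_closedD[OF L ab(2) _ ab(4)] by blast
  qed
  thus False using K_meets_H[OF K(1,2)] LH by blast
qed

text \<open>
  The odd components outside \<open>D\<close> use up all of \<open>X - S - {x}\<close> and the vertex \<open>h\<close> provided by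
  \<open>H \<unlhd> H'\<close>, so an edge from \<open>x\<close> into \<open>K\<close> would be allowed.
\<close>

lemma no_edge_from_up:
  assumes x: "x \<in> X" "x \<notin> S" "x \<in> up E V H"
    and K: "K \<in> D" "K \<in> \<K>" "y \<in> K"
  shows "\<not> E x y"
proof
  assume xy: "E x y"
  obtain H' where "x \<in> H'" "cath_le E V H H'" using x(3) by (auto simp: up_def)
  then obtain Z where Z: "Z \<subseteq> V" "closed_in (allowed E V) V Z" "H \<union> H' \<subseteq> Z"
    and Zw: "\<forall>w\<in>Z - H. \<exists>h\<in>H. matchable E (insert h (Z - H - {w}))"
    by (auto simp: cath_le_def)
  have xV: "x \<in> V" using x XV by blast
  have x_Vh: "x \<notin> Vh" using x by (auto simp: S_def)
  obtain h where h: "h \<in> H" "matchable E (insert h (Z - H - {x}))"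
    using bspec[OF Zw, of x] x_Vh H_Vh \<open>x \<in> H'\<close> Z(3) by blast
  \<comment> \<open>Filling up with a perfect matching outside \<open>Z\<close> eliminates the
    unknown \<open>Z\<close>: what remains is a matching of \<open>V - H - {x}\<close> together with
    one vertex \<open>h\<close> of \<open>H\<close>.\<close>
  have "matchable E (V - Z)"
    using V_matchable pm_closed_allowed(2)[OF _ Z(2,1)] unfolding matchable_def by blast
  define W where "W = insert h (V - H - {x})"
  have "matchable E (insert h (Z - H - {x}) \<union> (V - Z))"
    using h Z(3) by (intro matchable_Un \<open>matchable E (V - Z)\<close>) auto
  moreover have "insert h (Z - H - {x}) \<union> (V - Z) = W"
    using Z(1,3) h(1) \<open>x \<in> H'\<close> by (auto simp: W_def)
  ultimately obtain f where f: "pm E W f" by (auto simp: matchable_def)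
  have WV: "W \<subseteq> V" using h(1) H_V by (auto simp: W_def)
  have finW: "finite W" using fin WV finite_subset by blast
  define T where "T = X \<inter> W"
  have K_out: "L \<inter> Vh = {}" if "L \<in> \<K> - D" for L
    using that in_Vh[of _ L] by (auto simp: VB_def)
  have sub: "L \<subseteq> W - T" if L: "L \<in> \<K> - D" for L
    using K_out[OF L] K_props(2,3)[of L] L H_Vh x(1) by (auto simp: W_def T_def)
  have out: "u \<in> L \<union> T" if "L \<in> \<K> - D" "k \<in> L" "u \<in> W" "E k u" for L k u
    using K_props(7)[of L k u] that WV by (auto simp: T_def)
  have T_W: "T \<subseteq> W" by (simp add: T_def)
  have dis: "L \<inter> L' = {}" if "L \<in> \<K> - D" "L' \<in> \<K> - D" "L \<noteq> L'" for L L'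
    using that K_disjoint by blast
  have od: "odd (card L)" if "L \<in> \<K> - D" for L using that K_props(5) by blast
  have S_X: "S \<subseteq> X" by (auto simp: S_def)
  have "card (\<K> - D) = card \<K> - card (D \<inter> \<K>)"
    using finite_K by (simp add: card_Diff_subset_Int Int_commute)
  \<comment> \<open>\<open>D\<close> contains as many odd components as \<open>S\<close> has
    elements, so the barrier count stays tight outside \<open>D\<close>.\<close>
  hence cK: "card (\<K> - D) = card (X - S)"
    using card_D_K bar finite_X S_X by (simp add: card_Diff_subset finite_subset)
  have cX: "card (X - S) = Suc (card (X - S - {x}))"
    using x finite_X by (intro card_Suc_Diff1[symmetric]) auto
  have T_eq: "T = (X - S - {x}) \<union> ({h} \<inter> X)"
    using X_Int_H XV h(1) by (auto simp: T_def W_def)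
  \<comment> \<open>The odd components outside \<open>D\<close> need \<open>card (X - S)\<close>
    partners in \<open>T\<close>, and removing \<open>x\<close> has cost one; only \<open>h\<close>
    can replace it.\<close>
  have hX: "h \<in> X"
  proof (rule ccontr)
    assume "h \<notin> X"
    hence "card T < card (\<K> - D)" using T_eq cK cX by simp
    moreover have "card (\<K> - D) \<le> card T"
      by (rule odd_family_matched(1)[OF finW f T_W]) (fact dis sub od out)+
    ultimately show False by simp
  qed
  hence "h \<in> S" using h(1) X_Int_H by blast
  have "card T \<le> card (X - S - {x}) + 1"
    unfolding T_eq using hX card_Un_le[of "X - S - {x}" "{h}"] by simp
  hence le: "card T \<le> card (\<K> - D)" using cK cX by simp
  have T_out: "\<exists>L\<in>\<K> - D. f t \<in> L" if "t \<in> T" for t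
    by (rule odd_family_matched(2)[OF finW f T_W]) (fact dis sub od out le that)+
  \<comment> \<open>As the count is tight, \<open>f\<close> sends all of \<open>T\<close> to odd
    components outside \<open>D\<close>, so a vertex of \<open>Vh - H\<close> is matched inside its
    own odd component, and not to \<open>h\<close>, the only vertex of \<open>H\<close> in
    \<open>W\<close>.\<close>
  have rest: "f v \<in> Vh - H" if v: "v \<in> Vh - H" for v
  proof -
    have vW: "v \<in> W" using v Vh_V x_Vh by (auto simp: W_def)
    obtain L where L: "L \<in> D" "L \<in> \<K>" "v \<in> L" using v S_H Vh_cases by blast
    have fv: "f v \<in> W" "f (f v) = v" "E v (f v)" using pmD[OF f vW] by auto
    have "f v \<notin> X"
    proof
      assume "f v \<in> X"
      then obtain L' where "L' \<in> \<K> - D" "v \<in> L'" using T_out[of "f v"] fv by (auto simp: T_def)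
      thus False using K_out v by blast
    qed
    hence "f v \<in> L" using K_props(7)[OF L(2,3) _ fv(3)] fv(1) WV by blast
    moreover have "f v \<notin> H" using fv(1) hX \<open>f v \<notin> X\<close> by (auto simp: W_def)
    ultimately show ?thesis using K_Vh[OF L(1)] by blast
  qed
  have "Vh - H \<subseteq> W" using Vh_V x_Vh by (auto simp: W_def)
  hence "pm E (W - (Vh - H)) f" using rest by (intro pm_restrict_Diff[OF f]) auto
  moreover have "W - (Vh - H) = insert h (V - Vh - {x})"
    using h(1) H_Vh by (auto simp: W_def)
  ultimately have "matchable E (insert h (V - Vh - {x}))" by (auto simp: matchable_def)
  \<comment> \<open>Inside \<open>Vh\<close> the matching is replaced by one missing
    \<open>h\<close> and \<open>y\<close>: \<open>h\<close> is already covered together with the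
    vertices outside \<open>Vh\<close>, and \<open>y\<close> is left free for
    \<open>x\<close>.\<close>
  hence "matchable E (insert h (V - Vh - {x}) \<union> (Vh - {h, y}))"
    using matchable_Vh_minus[OF \<open>h \<in> S\<close> K] by (intro matchable_Un) auto
  moreover have yVh: "y \<in> Vh" using K K_Vh by blast
  moreover have "y \<noteq> h" using hX K K_props(3) by blast
  ultimately obtain g where g: "pm E ({x, y} \<union> (insert h (V - Vh - {x}) \<union> (Vh - {h, y}))) g" "g x = y"
    using x_Vh h(1) H_Vh by (elim pm_with_edge[OF xy]) auto
  have "{x, y} \<union> (insert h (V - Vh - {x}) \<union> (Vh - {h, y})) = V"
    using xV yVh Vh_V h(1) H_Vh by blast
  hence "allowed E V x y" using g xV by (auto simp: allowed_def)
  hence "x \<in> Vh" using AE.sym Vh_closed yVh xV by (auto simp: closed_in_def)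
  thus False using x_Vh by simp
qed

text \<open>A neighbour outside \<open>Vh\<close> of an odd component of \<open>D\<close> must lie
  in \<open>X\<close>, where \<open>no_edge_from_up\<close> excludes it.\<close>

lemma up_edge_Vh:
  assumes "u \<in> up E V H" "u \<notin> Vh" "v \<in> Vh" "E u v"
  shows "v \<in> S"
proof (rule ccontr)
  assume "v \<notin> S"
  then obtain K where K: "K \<in> D" "K \<in> \<K>" "v \<in> K" using assms(3) Vh_cases by blast
  have uV: "u \<in> V" using assms(1) by (auto simp: up_def comps_def)
  have "u \<in> X" using K_props(7)[OF K(2,3) uV sym[OF assms(4)]] K_Vh[OF K(1)] assms(2) by blast
  moreover have "u \<notin> S" using assms(2) by (auto simp: S_def)
  ultimately show False using no_edge_from_up[OF _ _ assms(1) K] assms(4) by blast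
qed

lemma up_minus_Vh: "up E V H - Vh \<subseteq> up_at E V H S"
proof
  fix v assume v: "v \<in> up E V H - Vh"
  then obtain H' where H': "H' \<in> comps (allowed E V) V" "cath_le E V H H'" "v \<in> H'"
    by (auto simp: up_def)
  have "v \<in> V" using H' by (auto simp: comps_def)
  have H'_Vh: "H' \<inter> Vh = {}" using factor_comp_Vh[OF H'(1)] H'(3) v by blast
  have H'_up: "H' \<subseteq> up E V H - H" using H' H'_Vh H_Vh by (auto simp: up_def)
  obtain L where L: "L \<in> comps E (up E V H - H)" "v \<in> L" using ex_comp[of v] H'_up H'(3) by blast
  have LH: "L \<subseteq> up E V H - H" using L by (simp add: comps_def)
  have "H' \<subseteq> L"
    using comps_closedD[OF L(1)] allowed_in H'_up by (intro AE.comps_minD[OF H'(1,3) L(2)]) blast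
  \<comment> \<open>A walk inside \<open>L\<close> could enter \<open>Vh\<close> only at a vertex of
    \<open>S\<close> by \<open>up_edge_Vh\<close>, but \<open>S\<close> lies in \<open>H\<close> and
    \<open>L\<close> avoids \<open>H\<close>.\<close>
  have "L \<subseteq> - Vh"
  proof (rule comps_minD[OF L])
    fix a b assume ab: "a \<in> L" "a \<in> - Vh" "b \<in> L" "E a b"
    show "b \<in> - Vh"
      using up_edge_Vh[of a b] ab LH S_H by blast
  qed (use v in simp)
  hence "{h \<in> H. \<exists>l\<in>L. E l h} \<subseteq> S" using up_edge_Vh LH H_Vh by blast
  thus "v \<in> up_at E V H S" using H' L \<open>H' \<subseteq> L\<close> by (auto simp: up_at_def)
qed

theorem Vh_eq: "Vh = up E V H - up_at E V H S"
  using Vh_up Vh_not_up_at up_minus_Vh by blast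

end

section \<open>Translation to multigraphs\<close>

lemma adjD:
  assumes "finite_graph G" "adj G u v"
  shows "u \<in> verts G" "v \<in> verts G" "u \<noteq> v"
proof -
  obtain e where e: "e \<in> edges G" "ends G e = {u, v}" using assms(2) by (auto simp: adj_def)
  hence "{u, v} \<subseteq> verts G" "card {u, v} = 2" using assms(1) by (auto simp: finite_graph_def)
  thus "u \<in> verts G" "v \<in> verts G" "u \<noteq> v" by auto
qed

lemma ends_pair:
  assumes "finite_graph G" "e \<in> edges G" "v \<in> ends G e"
  obtains u where "ends G e = {v, u}" "u \<noteq> v"
proof -
  have "card (ends G e) = 2" using assms by (auto simp: finite_graph_def)
  then obtain a b where "ends G e = {a, b}" "a \<noteq> b" by (auto simp: card_2_iff)
  thus thesis using assms(3) that[of a] that[of b] by auto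
qed

lemma adj_simple_graph: "finite_graph G \<Longrightarrow> simple_graph (adj G)"
proof
  show "finite_graph G \<Longrightarrow> adj G u v \<Longrightarrow> adj G v u" for u v by (auto simp: adj_def insert_commute)
  show "finite_graph G \<Longrightarrow> \<not> adj G v v" for v using adjD(3) by metis
qed

lemma perfect_matching_pm:
  assumes G: "finite_graph G" and M: "perfect_matching G M"
  obtains f where "pm (adj G) (verts G) f" "\<And>e u v. e \<in> M \<Longrightarrow> ends G e = {u, v} \<Longrightarrow> f u = v"
proof -
  have ME: "M \<subseteq> edges G" and dis: "\<And>e e'. e \<in> M \<Longrightarrow> e' \<in> M \<Longrightarrow> e \<noteq> e' \<Longrightarrow> ends G e \<inter> ends G e' = {}"
    and cov: "(\<Union>e\<in>M. ends G e) = verts G"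
    using M by (auto simp: perfect_matching_def matching_def)
  define f where "f v = (SOME u. \<exists>e\<in>M. ends G e = {v, u})" for v
  have f: "f v = u" if e: "e \<in> M" "ends G e = {v, u}" for v u e
    unfolding f_def
  proof (rule some_equality)
    show "\<exists>e\<in>M. ends G e = {v, u}" using e by blast
    fix u' assume "\<exists>e\<in>M. ends G e = {v, u'}"
    then obtain e' where e': "e' \<in> M" "ends G e' = {v, u'}" by blast
    have "e' = e" using dis[OF e(1) e'(1)] e e' by auto
    thus "u' = u" using e e' by (auto simp: doubleton_eq_iff)
  qed
  have "pm (adj G) (verts G) f"
    unfolding pm_def
  proof
    fix v assume "v \<in> verts G"
    then obtain e where e: "e \<in> M" "v \<in> ends G e" using cov by blast
    obtain u where u: "ends G e = {v, u}" using ends_pair[OF G _ e(2)] e(1) ME by blast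
    have "f v = u" "f u = v" using f[OF e(1)] u by (auto simp: insert_commute)
    moreover have "adj G v u" using u e(1) ME by (auto simp: adj_def)
    ultimately show "f v \<in> verts G \<and> f (f v) = v \<and> adj G v (f v)" using adjD(2)[OF G] by auto
  qed
  thus thesis using that f by blast
qed

lemma pm_perfect_matching:
  assumes G: "finite_graph G" and f: "pm (adj G) (verts G) f"
  obtains M where "perfect_matching G M"
    "\<forall>v\<in>verts G. \<exists>e\<in>M. ends G e = {v, f v}"
proof -
  \<comment> \<open>Parallel edges require a choice; it depends on the pair of ends, so that
    \<open>v\<close> and \<open>f v\<close> select the same edge.\<close>
  define c where "c P = (SOME e. e \<in> edges G \<and> ends G e = P)" for P
  define M where "M = (\<lambda>v. c {v, f v}) ` verts G"
  have c: "c {v, f v} \<in> edges G \<and> ends G (c {v, f v}) = {v, f v}" if "v \<in> verts G" for v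
    unfolding c_def by (rule someI_ex) (use pmD(3)[OF f that] in \<open>auto simp: adj_def\<close>)
  have pair: "{x, f x} = {v, f v}" if "v \<in> verts G" "x \<in> {v, f v}" for v x
    using that(2) pmD(2)[OF f that(1)] by (elim insertE) (simp_all add: insert_commute)
  have "ends G (c {v, f v}) \<inter> ends G (c {u, f u}) = {}"
    if "u \<in> verts G" "v \<in> verts G" "c {v, f v} \<noteq> c {u, f u}" for u v
  proof -
    have "{v, f v} \<noteq> {u, f u}" using that(3) by metis
    hence "{v, f v} \<inter> {u, f u} = {}" using pair[OF that(1)] pair[OF that(2)] by (metis disjoint_iff)
    thus ?thesis using c that by simp
  qed
  hence "matching G M" using c by (auto simp: matching_def M_def)
  moreover have "(\<Union>e\<in>M. ends G e) = verts G"
    using c pmD(1)[OF f] by (auto simp: M_def)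
  ultimately have "perfect_matching G M" by (simp add: perfect_matching_def)
  thus thesis using that[of M] c by (auto simp: M_def)
qed

lemma factorizable_iff:
  assumes "finite_graph G"
  shows "factorizable G \<longleftrightarrow> matchable (adj G) (verts G)"
proof
  assume "factorizable G"
  then obtain M where M: "perfect_matching G M" by (auto simp: factorizable_def)
  obtain f where "pm (adj G) (verts G) f" by (rule perfect_matching_pm[OF assms M])
  thus "matchable (adj G) (verts G)" by (auto simp: matchable_def)
next
  assume "matchable (adj G) (verts G)"
  then obtain f where f: "pm (adj G) (verts G) f" by (auto simp: matchable_def)
  obtain M where "perfect_matching G M" by (rule pm_perfect_matching[OF assms f])
  thus "factorizable G" by (auto simp: factorizable_def)
qed

lemma adj_allowed_edges:
  assumes G: "finite_graph G"
  shows "adj (G\<lparr>edges := allowed_edges G\<rparr>) u v \<longleftrightarrow> allowed (adj G) (verts G) u v"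
proof
  assume "adj (G\<lparr>edges := allowed_edges G\<rparr>) u v"
  then obtain e M where e: "e \<in> edges G" "ends G e = {u, v}" "perfect_matching G M" "e \<in> M"
    by (auto simp: adj_def allowed_edges_def)
  obtain f where "pm (adj G) (verts G) f" "f u = v"
    by (rule perfect_matching_pm[OF G e(3)]) (use e(2,4) in blast)
  moreover have "u \<in> verts G" using adjD(1)[OF G, of u v] e by (auto simp: adj_def)
  ultimately show "allowed (adj G) (verts G) u v" by (auto simp: allowed_def)
next
  assume "allowed (adj G) (verts G) u v"
  then obtain f where f: "pm (adj G) (verts G) f" "u \<in> verts G" "f u = v" by (auto simp: allowed_def)
  obtain M where M: "perfect_matching G M" "\<forall>v\<in>verts G. \<exists>e\<in>M. ends G e = {v, f v}"
    by (rule pm_perfect_matching[OF G f(1)])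
  obtain e where e: "e \<in> M" "ends G e = {u, v}" using bspec[OF M(2) f(2)] f(3) by auto
  moreover have "e \<in> edges G" using M(1) e(1) by (auto simp: perfect_matching_def matching_def)
  ultimately show "adj (G\<lparr>edges := allowed_edges G\<rparr>) u v"
    using M(1) by (auto simp: adj_def allowed_edges_def)
qed

lemma verts_induced [simp]: "verts (induced G W) = verts G \<inter> W"
  by (simp add: induced_def)

lemma finite_graph_induced: "finite_graph G \<Longrightarrow> finite_graph (induced G W)"
  by (auto simp: finite_graph_def induced_def)

lemma adj_induced: "adj (induced G W) u v \<longleftrightarrow> adj G u v \<and> u \<in> W \<and> v \<in> W"
  by (auto simp: adj_def induced_def)

lemma finite_graph_delete_verts: "finite_graph G \<Longrightarrow> finite_graph (delete_verts G W)"
  by (simp add: delete_verts_def finite_graph_induced)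

lemma verts_delete_verts [simp]: "verts (delete_verts G W) = verts G - W"
  by (auto simp: delete_verts_def)

lemma adj_delete_verts:
  "adj (delete_verts G W) u v \<longleftrightarrow> adj G u v \<and> u \<in> verts G - W \<and> v \<in> verts G - W"
  by (simp add: delete_verts_def adj_induced)

lemma factorizable_delete_verts:
  assumes "finite_graph G"
  shows "factorizable (delete_verts G W) \<longleftrightarrow> matchable (adj G) (verts G - W)"
proof -
  have "factorizable (delete_verts G W) \<longleftrightarrow> matchable (adj (delete_verts G W)) (verts G - W)"
    using factorizable_iff[OF finite_graph_delete_verts[OF assms], of W] by simp
  also have "\<dots> \<longleftrightarrow> matchable (adj G) (verts G - W)"
    by (rule matchable_cong) (simp add: adj_delete_verts)
  finally show ?thesis .
qed

text \<open>Reachability classes are minimal closed sets: by symmetry any vertex of a class reaches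
  the whole class, and a closed set contains everything reachable from it.\<close>

lemma quotient_connected_rel:
  assumes G: "finite_graph G"
  shows "verts G // connected_rel G = comps (adj G) (verts G)"
proof -
  interpret simple_graph "adj G" by (rule adj_simple_graph[OF G])
  have symr: "(adj G)\<^sup>*\<^sup>* u v \<Longrightarrow> (adj G)\<^sup>*\<^sup>* v u" for u v
    by (induction rule: rtranclp_induct) (auto intro: sym converse_rtranclp_into_rtranclp)
  have closedD: "v \<in> Q" if "(adj G)\<^sup>*\<^sup>* u v" "u \<in> Q" "closed_in (adj G) (verts G) Q" for u v Q
    using that(1,2)
    by (induction rule: rtranclp_induct) (use that(3) adjD[OF G] in \<open>auto simp: closed_in_def\<close>)
  define cl where "cl u = {v \<in> verts G. (adj G)\<^sup>*\<^sup>* u v}" for u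
  have cl: "connected_rel G `` {u} = cl u" if "u \<in> verts G" for u
    using that by (auto simp: connected_rel_def cl_def)
  have cl_closed: "closed_in (adj G) (verts G) (cl u)" for u
    by (auto simp: closed_in_def cl_def intro: rtranclp.rtrancl_into_rtrancl)
  have "cl u \<in> comps (adj G) (verts G)" if u: "u \<in> verts G" for u
  proof -
    have "Q = cl u" if Q: "Q \<subseteq> cl u" "Q \<noteq> {}" "closed_in (adj G) (verts G) Q" for Q
    proof -
      obtain q where q: "q \<in> Q" using Q(2) by blast
      have "v \<in> Q" if "v \<in> cl u" for v
      proof (rule closedD[OF _ q Q(3)])
        have "(adj G)\<^sup>*\<^sup>* q u" "(adj G)\<^sup>*\<^sup>* u v" using q Q(1) that symr by (auto simp: cl_def)
        thus "(adj G)\<^sup>*\<^sup>* q v" by simp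
      qed
      thus ?thesis using Q(1) by blast
    qed
    moreover have "u \<in> cl u" "cl u \<subseteq> verts G" using u by (auto simp: cl_def)
    ultimately show ?thesis using cl_closed by (auto simp: comps_def)
  qed
  moreover have "\<exists>u\<in>verts G. C = cl u" if C: "C \<in> comps (adj G) (verts G)" for C
  proof -
    obtain u where u: "u \<in> C" "u \<in> verts G" using C by (auto simp: comps_def)
    have "closed_in (adj G) (verts G) C" using C by (simp add: comps_def)
    hence "cl u \<subseteq> C" using closedD[OF _ u(1)] by (auto simp: cl_def)
    moreover have "u \<in> cl u" using u by (simp add: cl_def)
    moreover have "\<forall>Q. Q \<subseteq> C \<and> Q \<noteq> {} \<and> closed_in (adj G) (verts G) Q \<longrightarrow> Q = C"
      using C by (simp add: comps_def)
    ultimately have "cl u = C" using cl_closed[of u] by blast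
    thus ?thesis using u by blast
  qed
  ultimately show ?thesis by (auto simp: quotient_def cl)
qed

lemma components_eq:
  assumes "finite_graph G"
  shows "components G = induced G ` comps (adj G) (verts G)"
  by (simp add: components_def quotient_connected_rel[OF assms])

lemma verts_comp: "C \<in> comps E (verts G) \<Longrightarrow> verts (induced G C) = C"
  by (auto simp: comps_def)

lemma factor_components_eq:
  assumes G: "finite_graph G"
  shows "factor_components G = induced G ` comps (allowed (adj G) (verts G)) (verts G)"
proof -
  let ?A = "G\<lparr>edges := allowed_edges G\<rparr>"
  have A: "finite_graph ?A" using G by (auto simp: finite_graph_def allowed_edges_def)
  have "adj ?A = allowed (adj G) (verts G)" using adj_allowed_edges[OF G] by (simp add: fun_eq_iff)
  hence "components ?A = induced ?A ` comps (allowed (adj G) (verts G)) (verts G)"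
    using components_eq[OF A] by simp
  moreover have "verts (induced ?A C) = C" if "C \<in> comps E (verts G)" for C E
    using that by (auto simp: comps_def)
  moreover have "factor_components G = (\<lambda>C. induced G (verts C)) ` components ?A"
    by (auto simp: factor_components_def)
  ultimately show ?thesis by (simp add: image_image cong: image_cong del: verts_induced)
qed

lemma verts_odd_components:
  assumes G: "finite_graph G"
  shows "verts ` odd_components G X = odd_comps (adj G) (verts G - X)" (is ?eq)
    and "card (odd_components G X) = card (odd_comps (adj G) (verts G - X))"
proof -
  let ?G = "delete_verts G X"
  have "comps (adj ?G) (verts ?G) = comps (adj G) (verts G - X)"
    by (simp, rule comps_cong) (simp add: adj_delete_verts)
  hence comp: "components ?G = induced ?G ` comps (adj G) (verts G - X)"
    using components_eq[OF finite_graph_delete_verts[OF G], of X] by simp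
  have v: "verts (induced ?G C) = C" if "C \<in> comps (adj G) (verts G - X)" for C
    using that by (auto simp: comps_def)
  have v': "verts (induced ?G C) = C" if "C \<in> odd_comps (adj G) (verts G - X)" for C
    using that v by (simp add: odd_comps_def)
  have eq: "odd_components G X = induced ?G ` odd_comps (adj G) (verts G - X)"
    unfolding odd_components_def odd_comps_def comp using v by (auto simp del: verts_induced)
  show ?eq unfolding eq by (simp add: image_image v' del: verts_induced cong: image_cong)
  have "inj_on (induced ?G) (odd_comps (adj G) (verts G - X))"
    using v' by (metis inj_onI)
  thus "card (odd_components G X) = card (odd_comps (adj G) (verts G - X))"
    by (simp add: eq card_image)
qed

text \<open>This makes the deficiency in the definition of a barrier zero.\<close>

lemma matching_number_factorizable:
  assumes G: "finite_graph G" and "factorizable G"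
  shows "2 * matching_number G = card (verts G)"
proof -
  have c: "2 * card M = card (\<Union>e\<in>M. ends G e)" if "matching G M" for M
  proof -
    have M: "M \<subseteq> edges G" "finite M"
      using that G finite_subset by (auto simp: matching_def finite_graph_def)
    have fe: "finite (ends G e)" "card (ends G e) = 2" if "e \<in> M" for e
      using that M G finite_subset by (auto simp: finite_graph_def)
    have "card (\<Union>e\<in>M. ends G e) = (\<Sum>e\<in>M. card (ends G e))"
      using fe M(2) \<open>matching G M\<close> by (intro card_UN_disjoint) (auto simp: matching_def)
    thus ?thesis using fe by simp
  qed
  obtain M where M: "perfect_matching G M" using assms(2) by (auto simp: factorizable_def)
  have "matching_number G = card M"
    unfolding matching_number_def
  proof (rule Max_eqI)
    have "{M. matching G M} \<subseteq> Pow (edges G)" by (auto simp: matching_def)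
    moreover have "finite (Pow (edges G))" using G by (simp add: finite_graph_def)
    ultimately show "finite (card ` {M. matching G M})" by (intro finite_imageI) (rule finite_subset)
    show "card M \<in> card ` {M. matching G M}" using M by (auto simp: perfect_matching_def)
    fix n assume "n \<in> card ` {M. matching G M}"
    then obtain N where N: "matching G N" "n = card N" by blast
    have "(\<Union>e\<in>N. ends G e) \<subseteq> verts G" using N G by (auto simp: matching_def finite_graph_def)
    hence "2 * card N \<le> card (verts G)"
      using c[OF N(1)] G card_mono by (metis finite_graph_def)
    also have "card (verts G) = 2 * card M" using c M by (auto simp: perfect_matching_def)
    finally show "n \<le> card M" using N by simp
  qed
  thus ?thesis using c M by (auto simp: perfect_matching_def)
qed

lemma barrier_iff:
  assumes "finite_graph G" "factorizable G"
  shows "barrier G X \<longleftrightarrow> X \<subseteq> verts G \<and> card (odd_comps (adj G) (verts G - X)) = card X"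
  using matching_number_factorizable[OF assms]
  by (auto simp: barrier_def verts_odd_components[OF assms(1)])

section \<open>Contraction and factor-criticality\<close>

lemma block_in:
  assumes "\<And>K L. K \<in> \<K> \<Longrightarrow> L \<in> \<K> \<Longrightarrow> K \<noteq> L \<Longrightarrow> K \<inter> L = {}" "K \<in> \<K>" "v \<in> K"
  shows "block \<K> v = K"
  using assms by (auto simp: block_def)

lemma block_out: "v \<notin> \<Union>\<K> \<Longrightarrow> block \<K> v = {v}"
  by (auto simp: block_def)

text \<open>Disjointness makes the blocks a partition, so the ends of an edge fall into one block
  exactly when a member of \<open>\<K>\<close> contains both. Those are the edges that
  \<open>contract\<close> drops, hence no loops arise.\<close>

lemma contract_graph:
  assumes G: "finite_graph G"
    and disj: "\<And>K L. K \<in> \<K> \<Longrightarrow> L \<in> \<K> \<Longrightarrow> K \<noteq> L \<Longrightarrow> K \<inter> L = {}"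
  shows "finite_graph (contract G \<K>)"
    and "P \<in> verts (contract G \<K>) \<Longrightarrow> Q \<in> verts (contract G \<K>) \<Longrightarrow>
      adj (contract G \<K>) P Q \<longleftrightarrow> qadj (adj G) P Q"
proof -
  have self: "v \<in> block \<K> v" for v by (simp add: block_def)
  have block_mem: "block \<K> u = block \<K> w" if "u \<in> block \<K> w" for u w
  proof (cases "\<exists>K\<in>\<K>. w \<in> K")
    case True
    then obtain K where K: "K \<in> \<K>" "w \<in> K" by blast
    hence "block \<K> w = K" "u \<in> K" using block_in[OF disj K] that by auto
    thus ?thesis using block_in[OF disj K(1)] by simp
  next
    case False
    thus ?thesis using that block_out[of w] by auto
  qed
  have same: "block \<K> u = block \<K> v \<longleftrightarrow> (\<exists>K\<in>\<K>. {u, v} \<subseteq> K)" if "u \<noteq> v" for u v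
  proof
    assume "block \<K> u = block \<K> v"
    hence "u \<in> block \<K> v" using self by blast
    thus "\<exists>K\<in>\<K>. {u, v} \<subseteq> K" using that by (auto simp: block_def)
  next
    assume "\<exists>K\<in>\<K>. {u, v} \<subseteq> K"
    thus "block \<K> u = block \<K> v" by (intro block_mem) (auto simp: block_def)
  qed
  show "finite_graph (contract G \<K>)"
    unfolding finite_graph_def
  proof (intro conjI ballI)
    fix e assume e: "e \<in> edges (contract G \<K>)"
    hence eG: "e \<in> edges G" "\<not> (\<exists>K\<in>\<K>. ends G e \<subseteq> K)" by (auto simp: contract_def)
    hence "card (ends G e) = 2" "ends G e \<subseteq> verts G" using G by (auto simp: finite_graph_def)
    then obtain u v where uv: "ends G e = {u, v}" "u \<noteq> v" "{u, v} \<subseteq> verts G"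
      by (auto simp: card_2_iff)
    hence "block \<K> u \<noteq> block \<K> v" using same[of u v] eG by simp
    thus "ends (contract G \<K>) e \<subseteq> verts (contract G \<K>)" "card (ends (contract G \<K>) e) = 2"
      using uv by (auto simp: contract_def)
  qed (use G in \<open>auto simp: finite_graph_def contract_def\<close>)
  assume P: "P \<in> verts (contract G \<K>)" and Q: "Q \<in> verts (contract G \<K>)"
  have PQ: "P = block \<K> u" if "u \<in> P" for u using block_mem P that by (auto simp: contract_def)
  have QQ: "Q = block \<K> u" if "u \<in> Q" for u using block_mem Q that by (auto simp: contract_def)
  show "adj (contract G \<K>) P Q \<longleftrightarrow> qadj (adj G) P Q"
  proof
    assume "adj (contract G \<K>) P Q"
    then obtain e where e: "e \<in> edges G" "\<not> (\<exists>K\<in>\<K>. ends G e \<subseteq> K)" "block \<K> ` ends G e = {P, Q}"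
      by (auto simp: adj_def contract_def)
    have "P \<in> block \<K> ` ends G e" unfolding e(3) by simp
    then obtain u where u: "u \<in> ends G e" "block \<K> u = P" by auto
    obtain v where v: "ends G e = {u, v}" "v \<noteq> u" using ends_pair[OF G e(1) u(1)] by blast
    have neq: "block \<K> u \<noteq> block \<K> v" using same[of u v] v e(2) by simp
    have "{block \<K> u, block \<K> v} = {P, Q}" using e(3) v(1) by simp
    hence "block \<K> v = Q" using u(2) neq by (auto simp: doubleton_eq_iff)
    moreover have "adj G u v" using e(1) v by (auto simp: adj_def)
    ultimately show "qadj (adj G) P Q" using u(2) neq self[of u] self[of v] by (auto simp: qadj_def)
  next
    assume "qadj (adj G) P Q"
    then obtain u v where uv: "P \<noteq> Q" "u \<in> P" "v \<in> Q" "adj G u v" by (auto simp: qadj_def)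
    then obtain e where e: "e \<in> edges G" "ends G e = {u, v}" by (auto simp: adj_def)
    have "u \<noteq> v" using adjD(3)[OF G uv(4)] .
    hence "\<not> (\<exists>K\<in>\<K>. {u, v} \<subseteq> K)" using same[of u v] PQ[OF uv(2)] QQ[OF uv(3)] uv(1) by simp
    hence "e \<in> edges (contract G \<K>)" using e by (simp add: contract_def)
    moreover have "ends (contract G \<K>) e = {P, Q}"
      unfolding PQ[OF uv(2)] QQ[OF uv(3)] using e(2) by (simp add: contract_def)
    ultimately show "adj (contract G \<K>) P Q" unfolding adj_def by blast
  qed
qed

lemma matchable_image:
  assumes "inj_on p A" "\<And>u v. u \<in> A \<Longrightarrow> v \<in> A \<Longrightarrow> E u v \<Longrightarrow> E' (p u) (p v)" "matchable E A"
  shows "matchable E' (p ` A)"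
proof -
  obtain f where f: "pm E A f" using assms(3) by (auto simp: matchable_def)
  note d = pmD[OF f]
  have "pm E' (p ` A) (\<lambda>P. p (f (the_inv_into A p P)))"
    unfolding pm_def using d assms(2) by (auto simp: the_inv_into_f_f[OF assms(1)])
  thus ?thesis by (auto simp: matchable_def)
qed

text \<open>The edge matching the contracted vertex starts at some \<open>h \<in> H\<close>;
  expanding \<open>H\<close> to this \<open>h\<close> alone gives the matching on the right, and
  collapsing \<open>h\<close> to \<open>H\<close> reverses the step.\<close>

lemma (in simple_graph) matchable_contract:
  assumes H: "H \<subseteq> Z" and w: "w \<in> Z - H"
  shows "matchable (qadj E) (insert H ((\<lambda>z. {z}) ` (Z - H)) - {{w}}) \<longleftrightarrow>
    (\<exists>h\<in>H. matchable E (insert h (Z - H - {w})))"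
proof
  let ?W = "insert H ((\<lambda>z. {z}) ` (Z - H)) - {{w}}"
  assume "matchable (qadj E) ?W"
  then obtain f where f: "pm (qadj E) ?W f" by (auto simp: matchable_def)
  have HW: "H \<in> ?W" using w by auto
  note d = pmD[OF f HW]
  have "f H \<noteq> H" using d(3) by (auto simp: qadj_def)
  then obtain z where z: "f H = {z}" "z \<in> Z - H" "z \<noteq> w" using d(1) by auto
  obtain h where h: "h \<in> H" "E h z" using d(3) z(1) by (auto simp: qadj_def)
  have "pm (qadj E) (?W - {H, {z}}) f"
    using d z HW by (intro pm_restrict_Diff[OF f]) auto
  moreover have W: "?W - {H, {z}} = (\<lambda>z. {z}) ` (Z - H - {w, z})" by auto
  ultimately have "matchable (qadj E) ((\<lambda>z. {z}) ` (Z - H - {w, z}))" by (auto simp: matchable_def)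
  hence "matchable E (the_elem ` (\<lambda>z. {z}) ` (Z - H - {w, z}))"
    by (rule matchable_image[rotated 2]) (auto simp: qadj_def inj_on_def)
  hence "matchable E (Z - H - {w, z})" by (simp add: image_image)
  hence "matchable E ({h, z} \<union> (Z - H - {w, z}))"
    using h by (intro matchable_Un matchable_pair) auto
  moreover have "{h, z} \<union> (Z - H - {w, z}) = insert h (Z - H - {w})" using z by auto
  ultimately show "\<exists>h\<in>H. matchable E (insert h (Z - H - {w}))" using h(1) by auto
next
  assume "\<exists>h\<in>H. matchable E (insert h (Z - H - {w}))"
  then obtain h where h: "h \<in> H" "matchable E (insert h (Z - H - {w}))" by blast
  \<comment> \<open>\<open>?p\<close> is injective on the set in question because \<open>h\<close>
    is its only element in \<open>H\<close>.\<close>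
  let ?p = "\<lambda>z. if z \<in> H then H else {z}"
  have "matchable (qadj E) (?p ` insert h (Z - H - {w}))"
    by (rule matchable_image[OF _ _ h(2)]) (use h(1) irrefl in \<open>auto simp: qadj_def inj_on_def\<close>)
  moreover have "?p ` insert h (Z - H - {w}) = insert H ((\<lambda>z. {z}) ` (Z - H)) - {{w}}"
    using h(1) w by auto
  ultimately show "matchable (qadj E) (insert H ((\<lambda>z. {z}) ` (Z - H)) - {{w}})" by simp
qed

lemma factor_critical_iff:
  assumes "finite_graph G"
  shows "factor_critical G \<longleftrightarrow> (\<forall>v\<in>verts G. matchable (adj G) (verts G - {v}))"
proof -
  have "matchable (adj G) (verts G - {v})" if "verts G - {v} = {}" for v unfolding that by simp
  thus ?thesis
    unfolding factor_critical_def factorizable_delete_verts[OF assms] verts_delete_verts by metis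
qed

lemma factor_critical_contract:
  assumes G: "finite_graph G" and H: "H \<noteq> {}" "H \<subseteq> Z" "Z \<subseteq> verts G"
    and ZH: "matchable (adj G) (Z - H)"
  shows "factor_critical (contract (induced G Z) {H}) \<longleftrightarrow>
    (\<forall>w\<in>Z - H. \<exists>h\<in>H. matchable (adj G) (insert h (Z - H - {w})))"
proof -
  interpret simple_graph "adj G" by (rule adj_simple_graph[OF G])
  let ?C = "contract (induced G Z) {H}"
  have fg: "finite_graph (induced G Z)" by (rule finite_graph_induced[OF G])
  have C: "finite_graph ?C" by (rule contract_graph(1)[OF fg]) auto
  have b: "block {H} v = (if v \<in> H then H else {v})" for v by (auto simp: block_def)
  have V: "verts ?C = insert H ((\<lambda>z. {z}) ` (Z - H))"
    using H by (auto simp: contract_def b)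
  have sub: "P \<subseteq> Z" if "P \<in> verts ?C" for P using that H by (auto simp: V)
  have adjC: "adj ?C P Q \<longleftrightarrow> qadj (adj G) P Q" if "P \<in> verts ?C" "Q \<in> verts ?C" for P Q
  proof -
    have "adj ?C P Q \<longleftrightarrow> qadj (adj (induced G Z)) P Q"
      using that by (intro contract_graph(2)[OF fg]) auto
    thus ?thesis using sub[OF that(1)] sub[OF that(2)] by (auto simp: qadj_def adj_induced)
  qed
  have "matchable (adj ?C) (verts ?C - {P}) \<longleftrightarrow> matchable (qadj (adj G)) (verts ?C - {P})" for P
    by (rule matchable_cong) (use adjC in auto)
  hence "factor_critical ?C \<longleftrightarrow> (\<forall>P\<in>verts ?C. matchable (qadj (adj G)) (verts ?C - {P}))"
    by (simp add: factor_critical_iff[OF C])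
  moreover have "matchable (qadj (adj G)) (verts ?C - {H})"
  proof -
    have "matchable (qadj (adj G)) ((\<lambda>z. {z}) ` (Z - H))"
      by (rule matchable_image[OF _ _ ZH]) (use irrefl in \<open>auto simp: qadj_def\<close>)
    moreover have "(\<lambda>z. {z}) ` (Z - H) = verts ?C - {H}" by (auto simp: V)
    ultimately show ?thesis by simp
  qed
  ultimately have "factor_critical ?C \<longleftrightarrow>
      (\<forall>w\<in>Z - H. matchable (qadj (adj G)) (verts ?C - {{w}}))"
    unfolding V by auto
  thus ?thesis unfolding V using matchable_contract[OF H(2)] by simp
qed

lemma separating_iff:
  assumes G: "finite_graph G"
  shows "separating G Z \<longleftrightarrow> Z \<subseteq> verts G \<and> closed_in (allowed (adj G) (verts G)) (verts G) Z"
proof -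
  interpret G: simple_graph "adj G" by (rule adj_simple_graph[OF G])
  interpret A: simple_graph "allowed (adj G) (verts G)" by (rule G.allowed_simple_graph)
  let ?F = "comps (allowed (adj G) (verts G)) (verts G)"
  have "(\<forall>C\<in>?F. C \<subseteq> Z \<or> C \<inter> Z = {}) \<longleftrightarrow> closed_in (allowed (adj G) (verts G)) (verts G) Z"
    if Z: "Z \<subseteq> verts G"
  proof (intro iffI ballI)
    assume *: "\<forall>C\<in>?F. C \<subseteq> Z \<or> C \<inter> Z = {}"
    show "closed_in (allowed (adj G) (verts G)) (verts G) Z"
      unfolding closed_in_def
    proof (intro ballI impI)
      fix a b assume ab: "a \<in> Z" "b \<in> verts G" "allowed (adj G) (verts G) a b"
      obtain C where C: "C \<in> ?F" "a \<in> C" using A.ex_comp[of a] ab Z by blast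
      have "b \<in> C" using A.comps_closedD[OF C ab(2,3)] .
      thus "b \<in> Z" using * C ab(1) by blast
    qed
  next
    fix C assume cl: "closed_in (allowed (adj G) (verts G)) (verts G) Z" and C: "C \<in> ?F"
    show "C \<subseteq> Z \<or> C \<inter> Z = {}"
    proof (cases "C \<inter> Z = {}")
      case False
      then obtain v where "v \<in> C" "v \<in> Z" by blast
      hence "C \<subseteq> Z"
        by (rule A.comps_minD[OF C])
          (use cl G.allowed_in in \<open>unfold closed_in_def, blast\<close>)
      thus ?thesis ..
    qed simp
  qed
  moreover have "(\<forall>H\<in>factor_components G. verts H \<subseteq> Z \<or> verts H \<inter> Z = {}) \<longleftrightarrow>
      (\<forall>C\<in>?F. C \<subseteq> Z \<or> C \<inter> Z = {})"
    unfolding factor_components_eq[OF G] ball_simps by (rule ball_cong) (simp_all only: verts_comp)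
  ultimately show ?thesis by (auto simp: separating_def)
qed

section \<open>The cathedral structure in terms of adjacency\<close>

context
  fixes G :: "('v, 'e) mgraph"
  assumes G: "finite_graph G" and fac: "factorizable G"
begin

abbreviation "FC \<equiv> comps (allowed (adj G) (verts G)) (verts G)"

lemma cathedral_le_iff:
  assumes C: "C \<in> FC" "C' \<in> FC"
  shows "cathedral_le G (induced G C) (induced G C') \<longleftrightarrow> cath_le (adj G) (verts G) C C'"
proof -
  interpret G: simple_graph "adj G" by (rule adj_simple_graph[OF G])
  have v: "verts (induced G C) = C" "verts (induced G C') = C'"
    using verts_comp[OF C(1)] verts_comp[OF C(2)] by auto
  have mem: "induced G C \<in> factor_components G" "induced G C' \<in> factor_components G"
    using C by (auto simp: factor_components_eq[OF G])
  have "factor_critical (contract (induced G Z) {C}) \<longleftrightarrow>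
      (\<forall>w\<in>Z - C. \<exists>h\<in>C. matchable (adj G) (insert h (Z - C - {w})))"
    if Z: "Z \<subseteq> verts G" "closed_in (allowed (adj G) (verts G)) (verts G) Z" "C \<subseteq> Z" for Z
  proof (rule factor_critical_contract[OF G _ Z(3,1)])
    show "C \<noteq> {}" using C(1) by (simp add: comps_def)
    obtain f where f: "pm (adj G) (verts G) f"
      using fac by (auto simp: factorizable_iff[OF G] matchable_def)
    have fZ: "pm (adj G) Z f" by (rule G.pm_closed_allowed(1)[OF f Z(2,1)])
    have fC: "pm (adj G) C f"
      using C(1) by (intro G.pm_closed_allowed(1)[OF f]) (auto simp: comps_def)
    have "pm (adj G) (Z - C) f" by (rule pm_restrict_Diff[OF fZ Z(3)]) (rule pmD(1)[OF fC])
    thus "matchable (adj G) (Z - C)" by (auto simp: matchable_def)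
  qed
  thus ?thesis
    unfolding cathedral_le_def cath_le_def separating_iff[OF G] v using mem by auto
qed

lemma cathedral_le_components:
  "cathedral_le G (induced G C) H' \<Longrightarrow> \<exists>C'\<in>FC. H' = induced G C'"
  by (auto simp: cathedral_le_def factor_components_eq[OF G])

lemma upper_closed_eq:
  assumes C: "C \<in> FC"
  shows "upper_closed G (induced G C) = up (adj G) (verts G) C"
proof -
  have "{verts H' | H'. cathedral_le G (induced G C) H'}
      = {C' \<in> FC. cath_le (adj G) (verts G) C C'}" (is "?A = ?B")
  proof (intro set_eqI iffI)
    fix C' assume "C' \<in> ?A"
    then obtain C'' where C'': "C'' \<in> FC" "C' = verts (induced G C'')"
      "cathedral_le G (induced G C) (induced G C'')"
      using cathedral_le_components by blast
    have "C' = C''" unfolding C''(2) by (rule verts_comp[OF C''(1)])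
    thus "C' \<in> ?B" using C''(1,3) cathedral_le_iff[OF C C''(1)] by simp
  next
    fix C' assume C': "C' \<in> ?B"
    hence mem: "C' \<in> FC" and "cath_le (adj G) (verts G) C C'" by simp_all
    hence "cathedral_le G (induced G C) (induced G C')" using cathedral_le_iff[OF C mem] by simp
    moreover have "C' = verts (induced G C')" using verts_comp[OF mem] by simp
    ultimately show "C' \<in> ?A" by blast
  qed
  thus ?thesis by (simp add: upper_closed_def up_def)
qed

lemma upper_eq:
  assumes C: "C \<in> FC"
  shows "upper G (induced G C) = up (adj G) (verts G) C - C"
  using upper_closed_eq[OF C] verts_comp[OF C] by (simp add: upper_def)

lemma upper_class_eq:
  assumes C: "C \<in> FC"
  shows "upper_class G (induced G C) S = up_at (adj G) (verts G) C S"
proof -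
  let ?U = "up (adj G) (verts G) C - C"
  have U: "?U \<subseteq> verts G" by (auto simp: up_def comps_def)
  have "comps (adj (induced G ?U)) (verts (induced G ?U)) = comps (adj G) ?U"
    using U by (simp add: Int_absorb1) (rule comps_cong, simp add: adj_induced)
  hence comp: "components (induced G ?U) = induced (induced G ?U) ` comps (adj G) ?U"
    using components_eq[OF finite_graph_induced[OF G], of ?U] by simp
  have v: "verts (induced (induced G ?U) L) = L" if "L \<in> comps (adj G) ?U" for L
    using that U by (auto simp: comps_def)
  have nb: "nbrs G L \<inter> C = {h \<in> C. \<exists>l\<in>L. adj G l h}" if "L \<in> comps (adj G) ?U" for L
    using that C by (auto simp: nbrs_def comps_def)
  have ex: "(\<exists>K\<in>components (induced G ?U). nbrs G (verts K) \<inter> C \<subseteq> S \<and> C' \<subseteq> verts K) \<longleftrightarrow>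
      (\<exists>L\<in>comps (adj G) ?U. {h \<in> C. \<exists>l\<in>L. adj G l h} \<subseteq> S \<and> C' \<subseteq> L)" for C'
    unfolding comp bex_simps by (rule bex_cong) (simp_all only: v nb)
  have neq: "induced G C' \<noteq> induced G C" if "C' \<in> FC" "C' \<subseteq> L" "L \<in> comps (adj G) ?U" for C' L
  proof -
    have "C' \<noteq> C" using that by (auto simp: comps_def)
    thus ?thesis using verts_comp[OF that(1)] verts_comp[OF C] by metis
  qed
  have vC: "verts (induced G C) = C" using verts_comp[OF C] .
  have "{verts H' | H'. H' \<in> factor_components G \<and> cathedral_le G (induced G C) H' \<and>
         H' \<noteq> induced G C \<and> (\<exists>K\<in>components (induced G ?U).
           nbrs G (verts K) \<inter> C \<subseteq> S \<and> verts H' \<subseteq> verts K)}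
      = {C' \<in> FC. cath_le (adj G) (verts G) C C' \<and>
         (\<exists>L\<in>comps (adj G) ?U. {h \<in> C. \<exists>l\<in>L. adj G l h} \<subseteq> S \<and> C' \<subseteq> L)}" (is "?A = ?B")
  proof (intro set_eqI iffI)
    fix C' assume "C' \<in> ?A"
    then obtain C'' where C'': "C'' \<in> FC" "C' = verts (induced G C'')"
      "cathedral_le G (induced G C) (induced G C'')"
      "\<exists>K\<in>components (induced G ?U). nbrs G (verts K) \<inter> C \<subseteq> S \<and> verts (induced G C'') \<subseteq> verts K"
      using cathedral_le_components by blast
    have "C' = C''" using C''(2) verts_comp[OF C''(1)] by simp
    thus "C' \<in> ?B"
      using C''(1,3,4) cathedral_le_iff[OF C C''(1)] ex verts_comp[OF C''(1)] by auto
  next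
    fix C' assume C': "C' \<in> ?B"
    hence "induced G C' \<in> factor_components G" by (auto simp: factor_components_eq[OF G])
    moreover have "verts (induced G C') = C'" using C' verts_comp by blast
    moreover have "cathedral_le G (induced G C) (induced G C')"
      using C' cathedral_le_iff[OF C] by blast
    moreover have "induced G C' \<noteq> induced G C" using C' neq by blast
    ultimately show "C' \<in> ?A" using C' ex[of C'] by (intro CollectI exI[of _ "induced G C'"]) auto
  qed
  thus ?thesis by (simp only: upper_class_def up_at_def upper_eq[OF C] vC)
qed

text \<open>A member of the quotient is the image of a single vertex under \<open>sim\<close>, so
  computing the image of \<open>s\<close> suffices.\<close>

lemma canonical_classI:
  assumes C: "C \<in> FC" and S: "s \<in> C" "S \<subseteq> C"
    and eq: "{v \<in> C. \<not> matchable (adj G) (verts G - {s, v})} = S"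
  shows "S \<in> canonical_classes G (induced G C)"
proof -
  interpret G: simple_graph "adj G" by (rule adj_simple_graph[OF G])
  interpret A: simple_graph "allowed (adj G) (verts G)" by (rule G.allowed_simple_graph)
  have "(\<exists>H\<in>factor_components G. s \<in> verts H \<and> v \<in> verts H) \<longleftrightarrow> v \<in> C" for v
  proof
    assume "\<exists>H\<in>factor_components G. s \<in> verts H \<and> v \<in> verts H"
    then obtain C' where C': "C' \<in> FC" "s \<in> C'" "v \<in> C'"
      using verts_comp by (auto simp: factor_components_eq[OF G])
    hence "C' = C" using A.comps_disjoint[OF C'(1) C] S(1) by blast
    thus "v \<in> C" using C' by simp
  next
    assume "v \<in> C"
    thus "\<exists>H\<in>factor_components G. s \<in> verts H \<and> v \<in> verts H"
      using C S(1) verts_comp[OF C] by (auto simp: factor_components_eq[OF G] intro!: bexI[of _ C])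
  qed
  hence "{(u, v). sim G u v} `` {s} = S"
    using eq by (auto simp: sim_def factorizable_delete_verts[OF G])
  moreover have "s \<in> verts G" using S(1) C by (auto simp: comps_def)
  ultimately have "S \<in> canonical_partition G"
    using quotientI[of s "verts G" "{(u, v). sim G u v}"] by (simp add: canonical_partition_def)
  thus ?thesis using S(2) verts_comp[OF C] by (simp add: canonical_classes_def del: verts_induced)
qed

end

text \<open>This is where odd-maximality is used, through \<open>odd_comps_critical\<close>.\<close>

lemma barrier_graphI:
  assumes G: "finite_graph G" and fac: "factorizable G" and X: "odd_maximal_barrier G X"
  shows "barrier_graph (adj G) (verts G) X"
proof -
  interpret simple_graph "adj G" by (rule adj_simple_graph[OF G])
  have op: "odd_part G X = \<Union>(odd_comps (adj G) (verts G - X))"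
    by (simp add: odd_part_def verts_odd_components(1)[OF G, symmetric])
  have b: "X \<subseteq> verts G" "card (odd_comps (adj G) (verts G - X)) = card X"
    using X by (auto simp: odd_maximal_barrier_def barrier_iff[OF G fac])
  have V: "matchable (adj G) (verts G)" using fac factorizable_iff[OF G] by simp
  have fin: "finite (verts G)" using G by (simp add: finite_graph_def)
  show ?thesis
  proof
    show "matchable (adj G) (K - {v})" if "K \<in> odd_comps (adj G) (verts G - X)" "v \<in> K" for K v
    proof (rule odd_comps_critical[OF fin V b _ that])
      fix Y assume Y: "Y \<noteq> {}" "Y \<subseteq> \<Union>(odd_comps (adj G) (verts G - X))"
      hence "\<not> barrier G (X \<union> Y)" using X by (auto simp: odd_maximal_barrier_def op)
      moreover have "X \<union> Y \<subseteq> verts G" using b(1) Y(2) by (auto simp: odd_comps_def comps_def)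
      ultimately show "card (odd_comps (adj G) (verts G - (X \<union> Y))) \<noteq> card (X \<union> Y)"
        by (simp add: barrier_iff[OF G fac])
    qed
  qed (use fin V b in auto)
qed

lemma bipartite_reduction_graph:
  assumes G: "finite_graph G" and B: "barrier_graph (adj G) (verts G) X"
  shows "finite_graph (bipartite_reduction G X)"
    and "verts (bipartite_reduction G X) = barrier_graph.VB (adj G) (verts G) X"
    and "P \<in> verts (bipartite_reduction G X) \<Longrightarrow> Q \<in> verts (bipartite_reduction G X) \<Longrightarrow>
      adj (bipartite_reduction G X) P Q \<longleftrightarrow> barrier_graph.EB (adj G) X P Q"
proof -
  interpret barrier_graph "adj G" "verts G" X by (rule B)
  let ?G = "delete_edges (delete_verts G (even_part G X)) (edges (induced G X))"
  have K: "verts ` odd_components G X = \<K>" by (rule verts_odd_components(1)[OF G])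
  have red: "bipartite_reduction G X = contract ?G \<K>"
    by (simp add: bipartite_reduction_def K)
  have fg: "finite_graph ?G"
    using finite_graph_delete_verts[OF G, of "even_part G X"] by (auto simp: finite_graph_def delete_edges_def)
  have "odd_part G X = \<Union>\<K>" by (simp add: odd_part_def K)
  hence vG: "verts ?G = X \<union> \<Union>\<K>"
    using XV K_props(2) by (auto simp: delete_edges_def even_part_def)
  have adjG: "adj ?G u v \<longleftrightarrow> adj G u v \<and> u \<in> verts ?G \<and> v \<in> verts ?G \<and> \<not> (u \<in> X \<and> v \<in> X)" for u v
    by (auto simp: adj_def delete_edges_def delete_verts_def induced_def)
  show "finite_graph (bipartite_reduction G X)"
    unfolding red by (rule contract_graph(1)[OF fg]) (rule K_disjoint)
  have bX: "block \<K> x = {x}" if "x \<in> X" for x using that K_props(3) by (intro block_out) blast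
  have bK: "block \<K> k = K" if "K \<in> \<K>" "k \<in> K" for k K by (rule block_in[OF K_disjoint that])
  have "block \<K> ` K = {K}" if "K \<in> \<K>" for K
    using bK[OF that] K_props(4)[OF that] by auto
  hence "block \<K> ` \<Union>\<K> = \<K>" by (auto simp: image_Union)
  moreover have "block \<K> ` X = (\<lambda>x. {x}) ` X" using bX by (rule image_cong[OF refl])
  ultimately have "block \<K> ` (X \<union> \<Union>\<K>) = VB" by (simp add: VB_def image_Un)
  thus V: "verts (bipartite_reduction G X) = VB"
    by (simp add: red contract_def vG)
  assume PQ: "P \<in> verts (bipartite_reduction G X)" "Q \<in> verts (bipartite_reduction G X)"
  hence "adj (bipartite_reduction G X) P Q \<longleftrightarrow> qadj (adj ?G) P Q"
    unfolding red by (intro contract_graph(2)[OF fg]) (rule K_disjoint)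
  moreover have "P \<subseteq> verts ?G" "Q \<subseteq> verts ?G" using PQ unfolding V vG by (auto simp: VB_def)
  ultimately show "adj (bipartite_reduction G X) P Q \<longleftrightarrow> EB P Q"
    by (auto simp: EB_def qadj_def adjG)
qed

theorem theorem8:
  fixes G :: "('v, 'e) mgraph"
    and X :: "'v set"
    and D :: "('v set, 'e) mgraph"
  assumes "finite_graph G"
    and "factorizable G"
    and "odd_maximal_barrier G X"
    and "D \<in> DM_components (bipartite_reduction G X)"
  shows "\<exists>H\<in>factor_components G.
           X \<inter> verts (expansion G X D) \<in> canonical_classes G H \<and>
           verts (expansion G X D) =
             upper_closed G H - upper_class G H (X \<inter> verts (expansion G X D))"
proof -
  note G = assms(1)
  have bg: "barrier_graph (adj G) (verts G) X" by (rule barrier_graphI[OF assms(1-3)])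
  then interpret barrier_graph "adj G" "verts G" X .
  let ?B = "bipartite_reduction G X"
  note B = bipartite_reduction_graph[OF G bg]
  \<comment> \<open>\<open>EB\<close> is a relation on arbitrary sets and agrees with
    \<open>adj ?B\<close> on the vertices, which is all that \<open>allowed\<close> depends
    on.\<close>
  have "allowed (adj ?B) (verts ?B) = allowed EB VB"
    using allowed_cong[of "verts ?B" "adj ?B" EB] B by simp
  then obtain C where C: "C \<in> comps (allowed EB VB) (verts ?B)" "D = induced ?B C"
    using assms(4) factor_components_eq[OF B(1)] by auto
  have D: "verts D \<in> comps (allowed EB VB) VB"
    using C(1) unfolding C(2) verts_comp[OF C(1)] by (simp add: B(2))
  interpret DM_component "adj G" "verts G" X "verts D"
    by unfold_locales (rule D)
  have expansion: "verts (expansion G X D) = Vh"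
  proof -
    have "{x \<in> X. {x} \<in> verts D} \<union>
        \<Union>{verts K | K. K \<in> odd_components G X \<and> verts K \<in> verts D} = Vh"
    proof -
      have "{verts K | K. K \<in> odd_components G X \<and> verts K \<in> verts D} = \<K> \<inter> verts D"
        unfolding verts_odd_components(1)[OF G, of X, symmetric] by blast
      moreover have "Vh = \<Union>(verts D \<inter> (\<lambda>x. {x}) ` X) \<union> \<Union>(\<K> \<inter> verts D)"
        using D_VB unfolding Vh_def VB_def by blast
      ultimately show ?thesis by auto
    qed
    thus ?thesis using Vh_V by (auto simp: expansion_def)
  qed
  \<comment> \<open>\<open>H\<close> is taken as the factor-component of an arbitrary vertex of
    \<open>S\<close>.\<close>
  obtain s where s: "s \<in> S" using S_nonempty by blast
  interpret A: simple_graph "allowed (adj G) (verts G)" by (rule allowed_simple_graph)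
  have "s \<in> verts G" using s XV by (auto simp: S_def)
  then obtain H where HC: "H \<in> comps (allowed (adj G) (verts G)) (verts G)" "s \<in> H"
    using A.ex_comp by blast
  interpret DM_factor "adj G" "verts G" X "verts D" H
    by unfold_locales (use HC s in auto)
  have XVh: "X \<inter> Vh = S" by (simp add: S_def)
  show ?thesis
    unfolding expansion XVh
  proof (intro bexI conjI)
    show "induced G H \<in> factor_components G" using HC(1) by (simp add: factor_components_eq[OF G])
    show "S \<in> canonical_classes G (induced G H)"
      by (rule canonical_classI[OF G assms(2) HC S_H canonical_class[OF s]])
    show "Vh = upper_closed G (induced G H) - upper_class G (induced G H) S"
      unfolding upper_closed_eq[OF assms(1,2) HC(1)] upper_class_eq[OF assms(1,2) HC(1)] by (rule Vh_eq)
  qed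
qed

end
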